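(* Let $n,k\geq 1$. Let $A^{(k)}_n(x)$ be the $1/k$-Eulerian polynomial, and let $a^{(k)}_n(x)=\frac{A^{(k)}_n(x)-x^{n}A^{(k)}_n(1/x)}{1-x}$ and $b^{(k)}_n(x)=\frac{x^{n-1}A^{(k)}_n(1/x)-A^{(k)}_n(x)}{1-x}$ (so that $A^{(k)}_n(x)=a^{(k)}_n(x)+x\,b^{(k)}_n(x)$ is its symmetric decomposition). Then $$a^{(k)}_{n}(x)=\sum_{F\in \overline{\mathcal{F}}_{n}(k)}x^{\mathrm{lleaf}(F)-\mathrm{si}(F)}=\sum_{i=0}^{\lfloor (n-1)/2\rfloor} \overline{\gamma}_{n,k,i}\,x^i(1+x)^{n-1-2i}$$ and $$x\,b^{(k)}_{n}(x)=\sum_{F\in \widehat{\mathcal{F}}_{n}(k)}x^{\mathrm{lleaf}(F)-\mathrm{si}(F)}=\sum_{i=1}^{\lfloor n/2\rfloor} \widehat{\gamma}_{n,k,i}\,x^i(1+x)^{n-2i},$$ where $\overline{\gamma}_{n,k,i}$ (resp. $\widehat{\gamma}_{n,k,i}$) is the number of forests in $\overline{\mathcal{F}}_{n}(k)$ (resp. $\widehat{\mathcal{F}}_{n}(k)$) having exactly $i$ old leaves and having no young leaves and no removable old leaves.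
   Context: The $1/k$-Eulerian polynomials are defined by $\sum_{n\geq 0}A^{(k)}_n(x)\frac{z^n}{n!}=\left(\frac{1-x}{e^{kz(x-1)}-x}\right)^{1/k}$. Trees: all trees are ordered (plane) rooted trees; the level of a node is its distance from the root (root at level 0); a leaf is a node with no children. An even $k$-ary tree is an ordered tree in which every node on an even level has exactly $k$ children. A pruned even $k$-ary tree is obtained from an even $k$-ary tree by deleting, for every even-level node all of whose children are leaves, all those children. For a finite set $M$ of positive integers, an increasing pruned even $k$-ary tree on $M$ is a pruned even $k$-ary tree whose nodes on even levels are labeled bijectively by $M$ (odd-level nodes are unlabeled) such that labels increase along every path from the root downward and, for each node, the labels of its children increase from left to right. An increasing pruned even $k$-ary forest on $M$ is a sequence $F=(T_1,\dots,T_m)$ of increasing pruned even $k$-ary trees whose label sets form a set partition of $M$ and whose root labels increase from left to right. $\mathcal{F}_n(k)$ is the set of such forests on $[n]=\{1,\dots,n\}$. For a labeled node $v$, its grand parent is the labeled node $u$ such that a child of $u$ is the parent of $v$; $v$ is then a grand child of $u$. A labeled non-root node $v$ is old if its label is the greatest among all grand children of its grand parent, and young otherwise; roots are neither old nor young. A labeled leaf is a leaf on an even level; $\mathrm{lleaf}(F)$ is the total number of labeled leaves of $F$. A singleton is a tree with only one node; $\mathrm{si}(F)$ is the number of singletons of $F$. For $F=(T_1,\dots,T_m)\in\mathcal{F}_n(k)$, an old leaf $u$ of $T_i$ is removable if: (1) $u$ is a grand child of the root of $T_i$ and is the only leaf among all grand children of the root of $T_i$; (2) the first $k-1$ children of the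 root of $T_i$ (from the left) are leaves; (3) if $i<m$, the label of $u$ is smaller than the label of the root of $T_{i+1}$. $\overline{\mathcal{F}}_n(k)$ is the set of $F\in\mathcal{F}_n(k)$ such that either the rightmost tree of $F$ is a singleton or the first $k-1$ children of the root of the rightmost tree of $F$ are leaves; $\widehat{\mathcal{F}}_n(k)=\mathcal{F}_n(k)\setminus\overline{\mathcal{F}}_n(k)$. *)

theory Defs
  imports Complex_Main "HOL-Computational_Algebra.Computational_Algebra" "HOL-Library.Disjoint_Sets"
begin

section \<open>The \<open>1/k\<close>-Eulerian polynomials\<close>

text \<open>
  The generating function is read as a formal power series in \<open>z\<close> for each real \<open>x \<noteq> 1\<close>. The series
  under the root has constant term \<open>1\<close>, and \<^term>\<open>fps_radical root k\<close> is its \<open>k\<close>-th root with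
  constant term \<open>1\<close>. A real polynomial is determined by its values off a finite set; the lemmas
  below show that the polynomials described by \<open>THE\<close> exist.
\<close>

definition eulerian_egf :: "nat \<Rightarrow> real \<Rightarrow> real fps" where
  "eulerian_egf k x =
     fps_radical root k (fps_const (1 - x) / (fps_exp (real k * (x - 1)) - fps_const x))"

definition eulerian_poly :: "nat \<Rightarrow> nat \<Rightarrow> real poly" where
  "eulerian_poly k n =
     (THE p. \<forall>x. x \<noteq> 1 \<longrightarrow> poly p x / fact n = fps_nth (eulerian_egf k x) n)"

definition eulerian_a :: "nat \<Rightarrow> nat \<Rightarrow> real poly" where
  "eulerian_a k n =
     (THE p. \<forall>x. x \<noteq> 0 \<and> x \<noteq> 1 \<longrightarrow>
        poly p x = (poly (eulerian_poly k n) x - x ^ n * poly (eulerian_poly k n) (1 / x)) / (1 - x))"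

definition eulerian_b :: "nat \<Rightarrow> nat \<Rightarrow> real poly" where
  "eulerian_b k n =
     (THE p. \<forall>x. x \<noteq> 0 \<and> x \<noteq> 1 \<longrightarrow>
        poly p x = (x ^ (n - 1) * poly (eulerian_poly k n) (1 / x) - poly (eulerian_poly k n) x) / (1 - x))"

lemma poly_eqI_cofinite:
  fixes p q :: "real poly"
  assumes "finite S" "\<And>x. x \<notin> S \<Longrightarrow> poly p x = poly q x"
  shows "p = q"
proof (rule ccontr)
  assume "p \<noteq> q"
  hence "finite {x. poly (p - q) x = 0}" by (intro poly_roots_finite) simp
  moreover have "- S \<subseteq> {x. poly (p - q) x = 0}" using assms(2) by auto
  ultimately have "finite (- S)" by (rule finite_subset[rotated])
  with assms(1) have "finite (UNIV :: real set)" by (simp add: finite_compl)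
  thus False using infinite_UNIV_char_0 by blast
qed

lemma eulerian_egf_0:
  assumes "k \<ge> 1" "x \<noteq> 1"
  shows "eulerian_egf k x $ 0 = 1"
  using assms by (simp add: eulerian_egf_def fps_divide_unit)

lemma eulerian_egf_Suc:
  assumes k: "k \<ge> 1" and x: "x \<noteq> 1"
  shows "eulerian_egf k x $ Suc n =
    ((\<Sum>j<n. real (Suc j) * eulerian_egf k x $ Suc j * (real k ^ (n - j) * (x - 1) ^ (n - Suc j) / fact (n - j)))
     + (\<Sum>j\<le>n. eulerian_egf k x $ j * (real k ^ (n - j) * (x - 1) ^ (n - j) / fact (n - j)))) / real (Suc n)"
proof -
  define c where "c = real k * (x - 1)"
  define E where "E = fps_exp c - fps_const x"
  define F where "F = eulerian_egf k x"
  obtain h where h: "k = Suc h" using k by (cases k) auto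
  have E0: "E $ 0 = 1 - x" by (simp add: E_def)
  have En: "E $ m = c ^ m / fact m" if "m > 0" for m using that by (simp add: E_def)
  define G where "G = fps_const (1 - x) / E"
  have GE: "G * E = fps_const (1 - x)"
    using x E0 unfolding G_def by (simp add: fps_divide_unit inverse_mult_eq_1 mult.assoc)
  have G0: "G $ 0 = 1" using x E0 by (simp add: G_def fps_divide_unit)
  have FG: "F ^ Suc h = G"
    using power_radical[of G root h] G0
    by (simp add: F_def eulerian_egf_def G_def E_def c_def h)
  have F0: "F $ 0 = 1" unfolding F_def by (rule eulerian_egf_0[OF k x])
  hence Fn: "F \<noteq> 0" by auto
  have "fps_deriv (F ^ Suc h * E) = 0" by (simp only: FG GE fps_deriv_const)
  hence "F ^ Suc h * fps_deriv E + fps_const (real k) * fps_deriv F * F ^ h * E = 0"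
    by (simp only: fps_deriv_mult fps_deriv_power h diff_Suc_1)
  hence "F ^ h * (fps_const (real k) * fps_deriv F * E + F * fps_deriv E) = 0"
    by (simp only: power_Suc2 distrib_left mult_ac add_ac)
  with Fn have ode: "fps_const (real k) * (fps_deriv F * E) + F * fps_deriv E = 0"
    by (simp add: mult.assoc)
  have dE: "fps_deriv E $ m = c * (c ^ m / fact m)" for m
    by (simp add: E_def)
  have "real k * (\<Sum>j\<le>n. real (Suc j) * F $ Suc j * E $ (n - j)) + (\<Sum>j\<le>n. F $ j * (c * (c ^ (n - j) / fact (n - j)))) = 0"
  proof -
    have "real k * (fps_deriv F * E) $ n + (F * fps_deriv E) $ n = 0"
      using arg_cong[OF ode, of "\<lambda>f. f $ n"] by simp
    hence "real k * (\<Sum>j\<le>n. fps_deriv F $ j * E $ (n - j)) +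
        (\<Sum>j\<le>n. F $ j * (c * (c ^ (n - j) / fact (n - j)))) = 0"
      by (simp only: fps_mult_nth atLeast0AtMost dE)
    thus ?thesis by (simp only: fps_deriv_nth Suc_eq_plus1)
  qed
  moreover have "(\<Sum>j\<le>n. real (Suc j) * F $ Suc j * E $ (n - j)) =
     (\<Sum>j<n. real (Suc j) * F $ Suc j * E $ (n - j)) + real (Suc n) * F $ Suc n * (1 - x)"
    using E0 by (simp add: lessThan_Suc_atMost[symmetric])
  moreover have "(\<Sum>j<n. real (Suc j) * F $ Suc j * E $ (n - j)) =
      (x - 1) * (\<Sum>j<n. real (Suc j) * F $ Suc j * (real k ^ (n - j) * (x - 1) ^ (n - Suc j) / fact (n - j)))"
    (is "_ = _ * ?S1")
    unfolding sum_distrib_left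
  proof (rule sum.cong[OF refl])
    fix j assume "j \<in> {..<n}"
    then obtain m where j: "n - j = Suc m" "n - Suc j = m"
      by (metis Suc_diff_Suc lessThan_iff)
    have "E $ (n - j) = (x - 1) * (real k ^ (n - j) * (x - 1) ^ (n - Suc j) / fact (n - j))"
      by (subst En) (simp_all add: j c_def power_mult_distrib)
    thus "real (Suc j) * F $ Suc j * E $ (n - j) =
      (x - 1) * (real (Suc j) * F $ Suc j * (real k ^ (n - j) * (x - 1) ^ (n - Suc j) / fact (n - j)))"
      by (simp only: mult_ac)
  qed
  moreover have "(\<Sum>j\<le>n. F $ j * (c * (c ^ (n - j) / fact (n - j)))) =
      real k * (x - 1) * (\<Sum>j\<le>n. F $ j * (real k ^ (n - j) * (x - 1) ^ (n - j) / fact (n - j)))"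
    (is "_ = _ * ?S2")
    unfolding sum_distrib_left
    by (intro sum.cong refl) (simp add: c_def power_mult_distrib)
  ultimately have "real k * ((x - 1) * ?S1 + real (Suc n) * F $ Suc n * (1 - x)) + real k * (x - 1) * ?S2 = 0"
    by (simp only:)
  moreover have "real k * ((x - 1) * a + b * (1 - x)) + real k * (x - 1) * d = (real k * (x - 1)) * (a + d - b)"
    for a b d :: real by (simp add: algebra_simps)
  ultimately have "(real k * (x - 1)) * (?S1 + ?S2 - real (Suc n) * F $ Suc n) = 0"
    by (simp only:)
  hence "?S1 + ?S2 - real (Suc n) * F $ Suc n = 0" (is "?a - _ = _") using k x
    by (subst (asm) mult_eq_0_iff) simp
  hence "?a = real (Suc n) * F $ Suc n" by (simp only: right_minus_eq)
  hence "F $ Suc n = ?a / real (Suc n)" by (simp only: nonzero_mult_div_cancel_left of_nat_eq_0_iff nat.distinct not_False_eq_True)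
  thus ?thesis unfolding F_def .
qed

lemma eulerian_egf_polynomial:
  assumes k: "k \<ge> 1"
  shows "\<exists>p. degree p \<le> n - 1 \<and> (\<forall>x. x \<noteq> 1 \<longrightarrow> poly p x = eulerian_egf k x $ n)"
proof (induction n rule: less_induct)
  case (less n)
  show ?case
  proof (cases n)
    case 0
    thus ?thesis using eulerian_egf_0[OF k] by (intro exI[of _ 1]) auto
  next
    case (Suc m)
    have "\<forall>j\<in>{..<n}. \<exists>p. degree p \<le> j - 1 \<and> (\<forall>x. x \<noteq> 1 \<longrightarrow> poly p x = eulerian_egf k x $ j)"
      using less by blast
    from bchoice[OF this] obtain P where
      P: "\<And>j. j < n \<Longrightarrow> degree (P j) \<le> j - 1"
         "\<And>j x. j < n \<Longrightarrow> x \<noteq> 1 \<Longrightarrow> poly (P j) x = eulerian_egf k x $ j"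
      by auto
    define X where "X = [:-1, 1 :: real:]"
    define q where "q = smult (1 / real (Suc m))
      ((\<Sum>j<m. smult (real (Suc j) * real k ^ (m - j) / fact (m - j)) (P (Suc j) * X ^ (m - Suc j)))
       + (\<Sum>j\<le>m. smult (real k ^ (m - j) / fact (m - j)) (P j * X ^ (m - j))))"
    have X: "degree (X ^ i) \<le> i" for i
      using degree_power_le[of X i] by (simp add: X_def)
    have d1: "degree (P (Suc j) * X ^ (m - Suc j)) \<le> m" if "j < m" for j
      using degree_mult_le[of "P (Suc j)" "X ^ (m - Suc j)"] X[of "m - Suc j"] P(1)[of "Suc j"] that Suc
      by linarith
    have d2: "degree (P j * X ^ (m - j)) \<le> m" if "j \<le> m" for j
      using degree_mult_le[of "P j" "X ^ (m - j)"] X[of "m - j"] P(1)[of j] that Suc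
      by linarith
    have "degree q \<le> m" unfolding q_def
      by (intro order.trans[OF degree_smult_le] degree_add_le degree_sum_le) (auto intro!: d1 d2)
    moreover have "poly q x = eulerian_egf k x $ n" if x: "x \<noteq> 1" for x
    proof -
      have "poly X x = x - 1" by (simp add: X_def)
      hence "poly q x = ((\<Sum>j<m. real (Suc j) * real k ^ (m - j) / fact (m - j) * (eulerian_egf k x $ Suc j * (x - 1) ^ (m - Suc j)))
       + (\<Sum>j\<le>m. real k ^ (m - j) / fact (m - j) * (eulerian_egf k x $ j * (x - 1) ^ (m - j)))) / real (Suc m)"
        using Suc x by (simp add: q_def poly_sum P(2) del: of_nat_Suc)
      also have "\<dots> = eulerian_egf k x $ n"
        unfolding Suc
        by (rule trans[OF _ eulerian_egf_Suc[OF k x, symmetric]],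
            rule arg_cong2[where f = "(/)", OF arg_cong2[where f = "(+)", OF sum.cong sum.cong]])
           (simp_all del: of_nat_Suc)
      finally show ?thesis .
    qed
    ultimately show ?thesis using Suc by auto
  qed
qed

lemma
  assumes k: "k \<ge> 1"
  shows eulerian_poly: "x \<noteq> 1 \<Longrightarrow> poly (eulerian_poly k n) x / fact n = eulerian_egf k x $ n"
    and degree_eulerian_poly: "degree (eulerian_poly k n) \<le> n - 1"
proof -
  obtain p where p: "degree p \<le> n - 1" "\<And>x. x \<noteq> 1 \<Longrightarrow> poly p x = eulerian_egf k x $ n"
    using eulerian_egf_polynomial[OF k] by metis
  have "eulerian_poly k n = smult (fact n) p" unfolding eulerian_poly_def
  proof (rule the_equality)
    fix q assume q: "\<forall>x. x \<noteq> 1 \<longrightarrow> poly q x / fact n = eulerian_egf k x $ n"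
    show "q = smult (fact n) p"
    proof (rule poly_eqI_cofinite[of "{1}"])
      fix x :: real assume "x \<notin> {1}"
      hence "poly q x / fact n = poly p x" using q p(2) by auto
      thus "poly q x = poly (smult (fact n) p) x" by (simp add: field_simps)
    qed simp
  qed (use p in auto)
  thus "x \<noteq> 1 \<Longrightarrow> poly (eulerian_poly k n) x / fact n = eulerian_egf k x $ n"
    and "degree (eulerian_poly k n) \<le> n - 1" using p by auto
qed

lemma reversed_polynomial:
  fixes p :: "real poly"
  assumes "degree p \<le> d"
  obtains q where "\<And>x. x \<noteq> 0 \<Longrightarrow> poly q x = x ^ d * poly p (1 / x)"
proof (rule that[of "monom 1 (d - degree p) * reflect_poly p"])
  fix x :: real assume "x \<noteq> 0"
  hence "poly (monom 1 (d - degree p) * reflect_poly p) x =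
      (x ^ (d - degree p) * x ^ degree p) * poly p (1 / x)"
    by (simp add: poly_monom poly_reflect_poly_nz inverse_eq_divide)
  also have "x ^ (d - degree p) * x ^ degree p = x ^ d"
    using assms by (simp flip: power_add)
  finally show "poly (monom 1 (d - degree p) * reflect_poly p) x = x ^ d * poly p (1 / x)" .
qed

lemma quotient_polynomial:
  fixes p :: "real poly"
  assumes "poly p 1 = 0"
  obtains q where "\<And>x. x \<noteq> 1 \<Longrightarrow> poly q x = poly p x / (1 - x)"
proof -
  obtain q where pq: "p = [:-1, 1:] * q" using assms poly_eq_0_iff_dvd[of p 1] by auto
  have "poly p x = (x - 1) * poly q x" for x by (subst pq) (simp add: algebra_simps)
  thus ?thesis by (intro that[of "- q"]) (simp add: field_simps)
qed

lemma eulerian_a: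
  assumes k: "k \<ge> 1" and x: "x \<noteq> 0" "x \<noteq> 1"
  shows "poly (eulerian_a k n) x =
    (poly (eulerian_poly k n) x - x ^ n * poly (eulerian_poly k n) (1 / x)) / (1 - x)"
proof -
  let ?A = "eulerian_poly k n"
  have "degree ?A \<le> n" using degree_eulerian_poly[OF k, of n] by simp
  then obtain R where R: "\<And>x. x \<noteq> 0 \<Longrightarrow> poly R x = x ^ n * poly ?A (1 / x)"
    by (rule reversed_polynomial) blast
  obtain q where q: "\<And>x. x \<noteq> 1 \<Longrightarrow> poly q x = poly (?A - R) x / (1 - x)"
    using quotient_polynomial[of "?A - R"] R[of 1] by auto
  have "eulerian_a k n = q" unfolding eulerian_a_def
  proof (rule the_equality)
    fix p
    assume "\<forall>x. x \<noteq> 0 \<and> x \<noteq> 1 \<longrightarrow> poly p x = (poly ?A x - x ^ n * poly ?A (1 / x)) / (1 - x)"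
    thus "p = q" by (intro poly_eqI_cofinite[of "{0, 1}"]) (simp_all add: q R)
  qed (simp add: q R)
  thus ?thesis using x by (simp add: q R)
qed

lemma eulerian_b:
  assumes k: "k \<ge> 1" and x: "x \<noteq> 0" "x \<noteq> 1"
  shows "poly (eulerian_b k n) x =
    (x ^ (n - 1) * poly (eulerian_poly k n) (1 / x) - poly (eulerian_poly k n) x) / (1 - x)"
proof -
  let ?A = "eulerian_poly k n"
  obtain R where R: "\<And>x. x \<noteq> 0 \<Longrightarrow> poly R x = x ^ (n - 1) * poly ?A (1 / x)"
    by (rule reversed_polynomial[OF degree_eulerian_poly[OF k, of n]]) blast
  obtain q where q: "\<And>x. x \<noteq> 1 \<Longrightarrow> poly q x = poly (R - ?A) x / (1 - x)"
    using quotient_polynomial[of "R - ?A"] R[of 1] by auto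
  have "eulerian_b k n = q" unfolding eulerian_b_def
  proof (rule the_equality)
    fix p
    assume "\<forall>x. x \<noteq> 0 \<and> x \<noteq> 1 \<longrightarrow> poly p x = (x ^ (n - 1) * poly ?A (1 / x) - poly ?A x) / (1 - x)"
    thus "p = q" by (intro poly_eqI_cofinite[of "{0, 1}"]) (simp_all add: q R)
  qed (simp add: q R)
  thus ?thesis using x by (simp add: q R)
qed

lemma eulerian_decomposition:
  assumes "n \<ge> 1" "k \<ge> 1"
  shows "eulerian_poly k n = eulerian_a k n + [:0, 1:] * eulerian_b k n"
proof (rule poly_eqI_cofinite[of "{0, 1}"])
  fix x :: real assume x: "x \<notin> {0, 1}"
  let ?A = "eulerian_poly k n"
  have "x ^ n = x * x ^ (n - 1)" using assms(1) by (cases n) auto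
  hence "(poly ?A x - x ^ n * poly ?A (1 / x)) + x * (x ^ (n - 1) * poly ?A (1 / x) - poly ?A x) =
      poly ?A x * (1 - x)"
    by (simp add: algebra_simps)
  moreover have "poly (eulerian_a k n + [:0, 1:] * eulerian_b k n) x =
      ((poly ?A x - x ^ n * poly ?A (1 / x)) + x * (x ^ (n - 1) * poly ?A (1 / x) - poly ?A x)) / (1 - x)"
    using x assms(2) by (simp add: eulerian_a eulerian_b add_divide_distrib)
  ultimately show "poly ?A x = poly (eulerian_a k n + [:0, 1:] * eulerian_b k n) x"
    using x by simp
qed simp


section \<open>Increasing pruned even \<open>k\<close>-ary forests\<close>

text \<open>
  An ordered tree whose even-level nodes carry labels. Odd-level nodes are unlabeled, so such a node
  is represented by the list of its children; it is a leaf iff that list is empty. Hence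
  \<open>Node l bs\<close> has the children \<open>bs\<close> and the grand children \<open>concat bs\<close>. Even-level nodes are
  identified with the subtrees hanging from them, which are distinct when the labels are.
\<close>

datatype tree = Node (label: nat) (children: "tree list list")

fun nodes :: "tree \<Rightarrow> tree list" where
  "nodes (Node l bs) = Node l bs # concat (map (\<lambda>b. concat (map nodes b)) bs)"

definition labels :: "tree \<Rightarrow> nat list" where
  "labels T = map label (nodes T)"

definition leaf :: "tree \<Rightarrow> bool" where
  "leaf v \<longleftrightarrow> children v = []"

definition grand_children :: "tree \<Rightarrow> tree set" where
  "grand_children u = set (concat (children u))"

definition even_kary :: "nat \<Rightarrow> tree \<Rightarrow> bool" where
  "even_kary k T \<longleftrightarrow> (\<forall>v\<in>set (nodes T). length (children v) = k)"

fun prune :: "tree \<Rightarrow> tree" where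
  "prune (Node l bs) = Node l (if \<forall>b\<in>set bs. b = [] then [] else map (map prune) bs)"

definition pruned_even_kary :: "nat \<Rightarrow> tree \<Rightarrow> bool" where
  "pruned_even_kary k T \<longleftrightarrow> (\<exists>S. even_kary k S \<and> T = prune S)"

definition increasing :: "tree \<Rightarrow> bool" where
  "increasing T \<longleftrightarrow> (\<forall>u\<in>set (nodes T).
     (\<forall>v\<in>grand_children u. label u < label v) \<and>
     (\<forall>b\<in>set (children u). sorted_wrt (<) (map label b)))"

definition inc_tree :: "nat \<Rightarrow> nat set \<Rightarrow> tree \<Rightarrow> bool" where
  "inc_tree k M T \<longleftrightarrow>
     pruned_even_kary k T \<and> distinct (labels T) \<and> set (labels T) = M \<and> increasing T"

text \<open>
  As the root labels are distinct and each root label occurs in its own tree, no two trees of a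
  forest share a label set, so passing to the set of label sets loses nothing.
\<close>

definition inc_forest :: "nat \<Rightarrow> nat set \<Rightarrow> tree list \<Rightarrow> bool" where
  "inc_forest k M F \<longleftrightarrow>
     (\<forall>T\<in>set F. inc_tree k (set (labels T)) T) \<and>
     partition_on M ((\<lambda>T. set (labels T)) ` set F) \<and>
     sorted_wrt (<) (map label F)"

definition forests :: "nat \<Rightarrow> nat \<Rightarrow> tree list set" where
  "forests n k = {F. inc_forest k {1..n} F}"

definition old :: "tree \<Rightarrow> tree \<Rightarrow> bool" where
  "old T v \<longleftrightarrow> (\<exists>u\<in>set (nodes T).
     v \<in> grand_children u \<and> (\<forall>w\<in>grand_children u. label w \<le> label v))"

definition young :: "tree \<Rightarrow> tree \<Rightarrow> bool" where
  "young T v \<longleftrightarrow> (\<exists>u\<in>set (nodes T). v \<in> grand_children u) \<and> \<not> old T v"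

definition old_leaves :: "tree list \<Rightarrow> tree set" where
  "old_leaves F = {v. leaf v \<and> (\<exists>T\<in>set F. old T v)}"

definition young_leaves :: "tree list \<Rightarrow> tree set" where
  "young_leaves F = {v. leaf v \<and> (\<exists>T\<in>set F. young T v)}"

definition lleaf :: "tree list \<Rightarrow> nat" where
  "lleaf F = length (filter leaf (concat (map nodes F)))"

definition singleton :: "tree \<Rightarrow> bool" where
  "singleton T \<longleftrightarrow> children T = []"

definition si :: "tree list \<Rightarrow> nat" where
  "si F = length (filter singleton F)"

definition first_children_leaves :: "nat \<Rightarrow> tree \<Rightarrow> bool" where
  "first_children_leaves k T \<longleftrightarrow> (\<forall>b\<in>set (take (k - 1) (children T)). b = [])"

definition removable :: "nat \<Rightarrow> tree list \<Rightarrow> nat \<Rightarrow> tree \<Rightarrow> bool" where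
  "removable k F i u \<longleftrightarrow>
     leaf u \<and> old (F ! i) u \<and>
     u \<in> grand_children (F ! i) \<and> (\<forall>w\<in>grand_children (F ! i). leaf w \<longrightarrow> w = u) \<and>
     first_children_leaves k (F ! i) \<and>
     (Suc i < length F \<longrightarrow> label u < label (F ! Suc i))"

definition removable_old_leaves :: "nat \<Rightarrow> tree list \<Rightarrow> tree set" where
  "removable_old_leaves k F = {u. \<exists>i<length F. removable k F i u}"

definition forests_bar :: "nat \<Rightarrow> nat \<Rightarrow> tree list set" where
  "forests_bar n k = {F \<in> forests n k. singleton (last F) \<or> first_children_leaves k (last F)}"

definition forests_hat :: "nat \<Rightarrow> nat \<Rightarrow> tree list set" where
  "forests_hat n k = forests n k - forests_bar n k"

definition gamma_bar :: "nat \<Rightarrow> nat \<Rightarrow> nat \<Rightarrow> nat" where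
  "gamma_bar n k i = card {F \<in> forests_bar n k.
     card (old_leaves F) = i \<and> young_leaves F = {} \<and> removable_old_leaves k F = {}}"

definition gamma_hat :: "nat \<Rightarrow> nat \<Rightarrow> nat \<Rightarrow> nat" where
  "gamma_hat n k i = card {F \<in> forests_hat n k.
     card (old_leaves F) = i \<and> young_leaves F = {} \<and> removable_old_leaves k F = {}}"

end

theory Submission
  imports Defs
begin

text \<open>
  Removing the smallest label splits a \<open>k\<close>-tuple of forests (the children of a node) into two such
  \<open>k\<close>-tuples and a forest into a \<open>k\<close>-tuple and a forest, so every weighted count below has an
  exponential generating function governed by a first-order differential equation. Write \<open>U\<close> for
  all \<open>k\<close>-tuples and \<open>F\<close> for all forests; then \<open>U' = k (U - 1 + x) U\<close> and \<open>F' = U F\<close>, which is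
  solved by the Eulerian series.

  If \<open>D\<close> counts the \<open>k\<close>-tuples whose first \<open>k - 1\<close> entries are empty, the two classes of forests
  satisfy \<open>H' = U H + D\<close> and \<open>K' = U K + (U - D)\<close>. A leaf is young iff it has a larger sibling,
  hence in a structure without young leaves a node with no grand children must come last among its
  siblings; this gives \<open>V' = k ((V - 1) V + y)\<close>, and \<open>U(z) - 1 = s (V(s z) - 1)\<close> for
  \<open>s = 1 + x\<close> and \<open>y = x / s\<^sup>2\<close>. Forbidding removable old leaves subtracts a series \<open>W\<close> coupled to the
  forest series, and the same rescaling carries the resulting systems to those of \<open>H\<close> and \<open>K\<close>.
  The symmetric decomposition is unique, so the \<open>\<gamma>\<close>-expansions identify \<open>a\<close> and \<open>x b\<close>.
\<close>

section \<open>Exponential generating functions of set functions\<close>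

text \<open>The constants s and y come from x^i (1+x)^(n-2i) = s^n y^i: a gamma-expansion of degree
  n is s^n times a polynomial in y, and the factor s^n is absorbed by replacing z by s z. For the
  first class the degree is n - 1, which leaves an extra factor 1/s. Both claims thus become
  identities between power series, proved without a group action on forests: two series agree
  because their difference solves a homogeneous linear equation with initial value zero. The
  obstacle is that removability compares a leaf with the root of the next tree, so the forests
  counted by the gamma-coefficients have no product structure; the violating ones need a recursion
  of their own. Subtrees carry arbitrary finite label sets, so all counts are functions of sets.
  That they depend on the cardinality alone is derived from the recursions, with no relabelling of
  trees.\<close>

definition card_inv_below :: "nat \<Rightarrow> (nat set \<Rightarrow> real) \<Rightarrow> bool" where
  "card_inv_below n S \<longleftrightarrow>
     (\<forall>M N. finite M \<longrightarrow> finite N \<longrightarrow> card M = card N \<longrightarrow> card M < n \<longrightarrow> S M = S N)"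

definition card_inv :: "(nat set \<Rightarrow> real) \<Rightarrow> bool" where
  "card_inv S \<longleftrightarrow> (\<forall>n. card_inv_below n S)"

text \<open>The labelled product: labels are distributed over two factors. On invariant arguments it
  is the binomial convolution.\<close>

definition conv :: "(nat set \<Rightarrow> real) \<Rightarrow> (nat set \<Rightarrow> real) \<Rightarrow> nat set \<Rightarrow> real" where
  "conv P R M = (\<Sum>A\<in>Pow M. P A * R (M - A))"

definition egf :: "(nat set \<Rightarrow> real) \<Rightarrow> real fps" where
  "egf S = Abs_fps (\<lambda>n. S {..<n} / fact n)"

lemma card_inv_belowD:
  assumes "card_inv_below n S" "finite M" "card M < n"
  shows "S M = S {..<card M}"
  using assms unfolding card_inv_below_def by (metis card_lessThan finite_lessThan)

lemma card_inv_belowI: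
  assumes "\<And>M. finite M \<Longrightarrow> card M < n \<Longrightarrow> S M = s (card M)"
  shows "card_inv_below n S"
  using assms unfolding card_inv_below_def by metis

lemma card_invD:
  assumes "card_inv S" "finite M"
  shows "S M = fact (card M) * egf S $ card M"
  using card_inv_belowD[of "Suc (card M)" S M] assms by (simp add: card_inv_def egf_def)

lemma sum_Pow_card:
  fixes h :: "nat \<Rightarrow> real"
  assumes "finite M"
  shows "(\<Sum>A\<in>Pow M. h (card A)) = (\<Sum>j\<le>card M. real (card M choose j) * h j)"
proof -
  have "(\<Sum>A\<in>Pow M. h (card A)) = (\<Sum>j\<le>card M. \<Sum>A\<in>{A\<in>Pow M. card A = j}. h (card A))"
    by (rule sum.group[symmetric]) (use assms in \<open>auto intro: card_mono\<close>)
  also have "\<dots> = (\<Sum>j\<le>card M. real (card M choose j) * h j)"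
    using n_subsets[OF assms] by (intro sum.cong refl) (simp add: Pow_def)
  finally show ?thesis .
qed

lemma conv_eq_binomial:
  assumes "card_inv_below n P" "card_inv_below n R" "finite M" "card M < n"
  shows "conv P R M = (\<Sum>j\<le>card M. real (card M choose j) * (P {..<j} * R {..<card M - j}))"
proof -
  have "conv P R M = (\<Sum>A\<in>Pow M. P {..<card A} * R {..<card M - card A})"
    unfolding conv_def
  proof (rule sum.cong[OF refl])
    fix A assume "A \<in> Pow M"
    hence A: "finite A" "card A \<le> card M" "card (M - A) = card M - card A" "finite (M - A)"
      using assms(3) by (auto intro: finite_subset card_mono simp: card_Diff_subset finite_subset)
    show "P A * R (M - A) = P {..<card A} * R {..<card M - card A}"
      using card_inv_belowD[OF assms(1) A(1)] card_inv_belowD[OF assms(2) A(4)] A assms(4) by simp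
  qed
  also have "\<dots> = (\<Sum>j\<le>card M. real (card M choose j) * (P {..<j} * R {..<card M - j}))"
    by (rule sum_Pow_card[OF assms(3)])
  finally show ?thesis .
qed

lemma card_inv_below_conv:
  assumes "card_inv_below n P" "card_inv_below n R"
  shows "card_inv_below n (conv P R)"
  using conv_eq_binomial[OF assms]
  by (rule card_inv_belowI[of n _ "\<lambda>c. \<Sum>j\<le>c. real (c choose j) * (P {..<j} * R {..<c - j})"])

lemma card_inv_below_add:
  assumes "card_inv_below n P" "card_inv_below n R"
  shows "card_inv_below n (\<lambda>M. P M + R M)"
  using assms unfolding card_inv_below_def by metis

lemma card_inv_below_diff:
  assumes "card_inv_below n P" "card_inv_below n R"
  shows "card_inv_below n (\<lambda>M. P M - R M)"
  using assms unfolding card_inv_below_def by metis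

lemma card_inv_below_cmult:
  assumes "card_inv_below n P"
  shows "card_inv_below n (\<lambda>M. c * P M)"
  using assms unfolding card_inv_below_def by metis

lemma card_inv_below_empty: "card_inv_below n (\<lambda>M. if M = {} then c else 0)"
  unfolding card_inv_below_def by (metis card_0_eq)

section \<open>Recursions on the minimum and differentiation\<close>

definition min_rec :: "(nat set \<Rightarrow> real) \<Rightarrow> (nat set \<Rightarrow> real) \<Rightarrow> bool" where
  "min_rec S S' \<longleftrightarrow> (\<forall>M. finite M \<longrightarrow> M \<noteq> {} \<longrightarrow> S M = S' (M - {Min M}))"

lemma min_recI:
  assumes "\<And>M. finite M \<Longrightarrow> M \<noteq> {} \<Longrightarrow> S M = S' (M - {Min M})"
  shows "min_rec S S'"
  using assms by (simp add: min_rec_def)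

text \<open>Deleting the minimum lowers the cardinality by one, so invariance of \<open>S'\<close>
  up to a size gives invariance of \<open>S\<close> one size further. The bounded notion exists for
  this step: \<open>S'\<close> is usually built from \<open>S\<close> itself, so invariance has to
  be reached size by size.\<close>

lemma card_inv_below_Suc:
  assumes "card_inv_below n S'" and "min_rec S S'"
  shows "card_inv_below (Suc n) S"
  unfolding card_inv_below_def
proof (intro allI impI)
  fix M N :: "nat set" assume *: "finite M" "finite N" "card M = card N" "card M < Suc n"
  show "S M = S N"
  proof (cases "M = {}")
    case True
    with * show ?thesis by auto
  next
    case False
    with * have "N \<noteq> {}" by auto
    have "card (M - {Min M}) = card (N - {Min N})" "card (M - {Min M}) < n"
      using * False \<open>N \<noteq> {}\<close> card_gt_0_iff[of M] by auto
    thus ?thesis using assms * False \<open>N \<noteq> {}\<close> unfolding card_inv_below_def min_rec_def by simp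
  qed
qed

lemma card_inv_below_0: "card_inv_below 0 S"
  by (simp add: card_inv_below_def)

lemmas card_inv_below_intros = card_inv_below_conv card_inv_below_add card_inv_below_diff
  card_inv_below_cmult card_inv_below_empty

lemma egf_conv:
  assumes "card_inv P" "card_inv R"
  shows "egf (conv P R) = egf P * egf R"
proof (rule fps_ext)
  fix n
  have "conv P R {..<n} = (\<Sum>j\<le>n. real (n choose j) * (P {..<j} * R {..<n - j}))"
    using conv_eq_binomial[of "Suc n" P R "{..<n}"] assms by (simp add: card_inv_def)
  thus "egf (conv P R) $ n = (egf P * egf R) $ n"
    by (simp add: egf_def fps_mult_nth sum_divide_distrib atLeast0AtMost binomial_fact)
qed

lemma egf_add: "egf (\<lambda>M. P M + R M) = egf P + egf R"
  and egf_diff: "egf (\<lambda>M. P M - R M) = egf P - egf R"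
  and egf_cmult: "egf (\<lambda>M. c * P M) = fps_const c * egf P"
  and egf_empty: "egf (\<lambda>M. if M = {} then c else 0) = fps_const c"
  by (rule fps_ext; simp add: egf_def add_divide_distrib diff_divide_distrib lessThan_empty_iff)+

lemmas egf_simps = egf_conv egf_add egf_diff egf_cmult egf_empty

text \<open>Differentiation cancels the factor n + 1 of \<open>fact (Suc n)\<close>. What is left of
  \<open>{..<Suc n}\<close> without its minimum is in general no initial segment; invariance of
  \<open>S'\<close> turns it into \<open>{..<n}\<close>.\<close>

lemma fps_deriv_egf:
  assumes "min_rec S S'" "card_inv S'"
  shows "fps_deriv (egf S) = egf S'"
proof (rule fps_ext)
  fix n
  have "S {..<Suc n} = S' ({..<Suc n} - {Min {..<Suc n}})" (is "_ = S' ?N")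
    using assms(1) unfolding min_rec_def by auto
  also have "card ?N = n" using Min_in[of "{..<Suc n}"] by (subst card_Diff_singleton) auto
  hence "S' ?N = S' {..<n}"
    using card_inv_belowD[of "Suc n" S' ?N] assms(2) by (simp add: card_inv_def)
  finally show "fps_deriv (egf S) $ n = egf S' $ n"
    by (simp add: egf_def field_simps del: of_nat_Suc)
qed

lemma egf_nth_0: "egf S $ 0 = S {}"
  by (simp add: egf_def)

section \<open>Uniqueness for linear differential equations, rescaling of the variable\<close>

text \<open>Coefficient m of d' is a combination of the coefficients 0..m of d, so vanishing
  propagates. As h is arbitrary, the lemma also serves Riccati equations once the difference of two
  solutions has been factored out.\<close>

lemma fps_linear_ode_zero:
  fixes d h :: "real fps"
  assumes "fps_deriv d = d * h" "d $ 0 = 0"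
  shows "d = 0"
proof (rule fps_ext)
  fix n show "d $ n = 0 $ n"
  proof (induction n rule: less_induct)
    case (less n)
    show ?case
    proof (cases n)
      case (Suc m)
      have "(d * h) $ m = 0"
        unfolding fps_mult_nth using less Suc by (intro sum.neutral) auto
      hence "fps_deriv d $ m = 0" by (simp only: assms(1))
      thus ?thesis using Suc by (simp del: of_nat_Suc)
    qed (use assms in simp)
  qed
qed

lemma fps_linear_ode_unique:
  fixes f g h r :: "real fps"
  assumes "fps_deriv f = h * f + r" "fps_deriv g = h * g + r" "f $ 0 = g $ 0"
  shows "f = g"
  using fps_linear_ode_zero[of "f - g" h] assms by (simp add: algebra_simps)

definition fps_scale :: "real \<Rightarrow> real fps \<Rightarrow> real fps" where
  "fps_scale s f = Abs_fps (\<lambda>n. s ^ n * f $ n)"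

lemma fps_scale_nth: "fps_scale s f $ n = s ^ n * f $ n"
  by (simp add: fps_scale_def)

lemma fps_scale_simps:
  "fps_scale s (f + g) = fps_scale s f + fps_scale s g"
  "fps_scale s (f - g) = fps_scale s f - fps_scale s g"
  "fps_scale s (fps_const c) = fps_const c"
  "fps_scale s 1 = 1"
  by (rule fps_ext; auto simp: fps_scale_nth algebra_simps)+

lemma fps_scale_mult: "fps_scale s (f * g) = fps_scale s f * fps_scale s g"
proof (rule fps_ext)
  fix n
  have "s ^ n * (f $ i * g $ (n - i)) = s ^ i * f $ i * (s ^ (n - i) * g $ (n - i))" if "i \<le> n" for i
    using that by (simp flip: power_add add: algebra_simps)
  thus "fps_scale s (f * g) $ n = (fps_scale s f * fps_scale s g) $ n"
    unfolding fps_scale_nth fps_mult_nth sum_distrib_left by (intro sum.cong) auto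
qed

lemma fps_deriv_scale: "fps_deriv (fps_scale s f) = fps_const s * fps_scale s (fps_deriv f)"
  by (rule fps_ext) (simp add: fps_scale_nth)


section \<open>Removing the smallest label\<close>

text \<open>Structural recursion in place of the existential over unpruned trees in
  \<open>pruned_even_kary\<close> and the quantifier over all nodes in \<open>increasing\<close>.
  The clause on a nonempty child says that a node whose children were all leaves has been
  pruned.\<close>

fun wf_tree :: "nat \<Rightarrow> tree \<Rightarrow> bool" where
  "wf_tree k (Node m bs) \<longleftrightarrow>
     (bs = [] \<or> length bs = k \<and> (\<exists>b\<in>set bs. b \<noteq> [])) \<and>
     (\<forall>b\<in>set bs. sorted_wrt (<) (map label b) \<and> (\<forall>t\<in>set b. m < label t \<and> wf_tree k t))"

definition forest_labels :: "tree list \<Rightarrow> nat list" where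
  "forest_labels F = concat (map labels F)"

definition kforests :: "nat \<Rightarrow> nat set \<Rightarrow> tree list set" where
  "kforests k M = {F. (\<forall>T\<in>set F. wf_tree k T) \<and> sorted_wrt (<) (map label F) \<and>
     distinct (forest_labels F) \<and> set (forest_labels F) = M}"

definition ktuples :: "nat \<Rightarrow> nat set \<Rightarrow> tree list list set" where
  "ktuples k M = {bs. length bs = k \<and>
     (\<forall>b\<in>set bs. (\<forall>t\<in>set b. wf_tree k t) \<and> sorted_wrt (<) (map label b)) \<and>
     distinct (forest_labels (concat bs)) \<and> set (forest_labels (concat bs)) = M}"

definition prune_top :: "tree list list \<Rightarrow> tree list list" where
  "prune_top bs = (if \<forall>b\<in>set bs. b = [] then [] else bs)"

lemma nodes_eq: "nodes (Node m bs) = Node m bs # concat (map nodes (concat bs))"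
  by (simp add: map_concat comp_def) (induction bs; simp)

declare nodes.simps [simp del]

lemma labels_Node: "labels (Node m bs) = m # forest_labels (concat bs)"
  by (simp add: labels_def[abs_def] forest_labels_def nodes_eq map_concat comp_def)

lemma forest_labels_simps [simp]:
  "forest_labels [] = []" "forest_labels (T # F) = labels T @ forest_labels F"
  "forest_labels (F @ G) = forest_labels F @ forest_labels G"
  by (simp_all add: forest_labels_def)

lemma label_in_labels: "label T \<in> set (labels T)"
  by (cases T) (simp add: labels_Node)

lemma labels_nonempty: "labels T \<noteq> []"
  by (cases T) (simp add: labels_Node)

lemma set_forest_labels: "set (forest_labels F) = (\<Union>T\<in>set F. set (labels T))"
  by (simp add: forest_labels_def)

lemma forest_labels_eq_Nil [simp]: "forest_labels F = [] \<longleftrightarrow> F = []"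
  by (cases F) (auto simp: labels_nonempty)

lemma tree_forest_induct [case_names Node]:
  assumes "\<And>m bs. (\<And>t. t \<in> set (concat bs) \<Longrightarrow> P t) \<Longrightarrow> P (Node m bs)"
  shows "P T"
  by (induction T) (rule assms, auto)

lemma root_in_nodes: "T \<in> set (nodes T)"
  by (cases T) (simp add: nodes_eq)

lemma even_kary_Node:
  "even_kary k (Node m bs) \<longleftrightarrow> length bs = k \<and> (\<forall>t\<in>set (concat bs). even_kary k t)"
  by (auto simp: even_kary_def nodes_eq)

lemma increasing_Node:
  "increasing (Node m bs) \<longleftrightarrow>
     (\<forall>t\<in>set (concat bs). m < label t \<and> increasing t) \<and>
     (\<forall>b\<in>set bs. sorted_wrt (<) (map label b))"
  by (auto simp: increasing_def nodes_eq grand_children_def)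

lemma pruned_even_kary_Node:
  "pruned_even_kary k (Node m bs) \<longleftrightarrow>
     (bs = [] \<or> length bs = k \<and> (\<exists>b\<in>set bs. b \<noteq> [])) \<and>
     (\<forall>t\<in>set (concat bs). pruned_even_kary k t)" (is "?L \<longleftrightarrow> ?R")
proof
  assume ?L
  then obtain S where S: "even_kary k S" "Node m bs = prune S"
    by (auto simp: pruned_even_kary_def)
  show ?R using S by (cases S) (auto simp: even_kary_Node pruned_even_kary_def split: if_splits)
next
  assume R: ?R
  show ?L
  proof (cases "bs = []")
    case True
    have "even_kary k (Node m (replicate k []))" by (auto simp: even_kary_Node)
    thus ?thesis using True by (auto simp: pruned_even_kary_def intro!: exI[of _ "Node m (replicate k [])"])
  next
    case False
    \<comment> \<open>Each grand child is unpruned separately; the choices form one function that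
      can be mapped over the children.\<close>
    define pick where "pick t = (SOME S. even_kary k S \<and> t = prune S)" for t
    have pick: "even_kary k (pick t) \<and> t = prune (pick t)" if "t \<in> set (concat bs)" for t
      unfolding pick_def by (rule someI_ex) (use R that in \<open>auto simp: pruned_even_kary_def\<close>)
    have "even_kary k (Node m (map (map pick) bs))"
      using R False pick by (auto simp: even_kary_Node)
    moreover have "map (map (prune \<circ> pick)) bs = map (map id) bs"
      using pick by (intro map_cong refl) (simp, metis)
    hence "prune (Node m (map (map pick) bs)) = Node m bs"
      using R False by (auto simp: map_map comp_def)
    ultimately show ?thesis unfolding pruned_even_kary_def by metis
  qed
qed

lemma wf_tree_iff: "wf_tree k T \<longleftrightarrow> pruned_even_kary k T \<and> increasing T"
proof (induction T rule: tree_forest_induct)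
  case (Node m bs)
  have "(\<forall>b\<in>set bs. \<forall>t\<in>set b. wf_tree k t) \<longleftrightarrow>
      (\<forall>t\<in>set (concat bs). pruned_even_kary k t \<and> increasing t)"
    using Node by auto
  thus ?case by (auto simp: pruned_even_kary_Node increasing_Node)
qed

lemma wf_tree_label_le:
  assumes "wf_tree k T" "l \<in> set (labels T)"
  shows "label T \<le> l"
  using assms
proof (induction T arbitrary: l rule: tree_forest_induct)
  case (Node m bs)
  show ?case
  proof (cases "l = m")
    case False
    then obtain t where t: "t \<in> set (concat bs)" "l \<in> set (labels t)"
      using Node.prems by (auto simp: labels_Node set_forest_labels)
    hence "label t \<le> l" "m < label t" using Node by auto
    thus ?thesis by simp
  qed simp
qed

lemma inc_forest_iff: "inc_forest k M F \<longleftrightarrow> F \<in> kforests k M"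
proof
  assume F: "inc_forest k M F"
  have sorted: "sorted_wrt (<) (map label F)" and wf: "\<forall>T\<in>set F. wf_tree k T \<and> distinct (labels T)"
    and part: "partition_on M ((\<lambda>T. set (labels T)) ` set F)"
    using F by (auto simp: inc_forest_def inc_tree_def wf_tree_iff)
  have "distinct (map label F)" using sorted by (simp add: strict_sorted_iff)
  hence inj: "distinct F" "inj_on label (set F)" by (auto simp: distinct_map)
  have disj: "set (labels S) \<inter> set (labels T) = {}" if "S \<in> set F" "T \<in> set F" "S \<noteq> T" for S T
  proof -
    \<comment> \<open>Equal label sets have equal minima, and the minimum of a tree is its root
      label. So two trees cannot hide behind one block of the partition.\<close>
    have "set (labels S) \<noteq> set (labels T)"
    proof
      assume eq: "set (labels S) = set (labels T)"
      have "label S \<le> label T" "label T \<le> label S"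
        using wf that eq label_in_labels by (metis wf_tree_label_le)+
      thus False using inj that by (auto dest: inj_onD)
    qed
    thus ?thesis using part that unfolding partition_on_def disjoint_def by blast
  qed
  have "distinct (forest_labels F)"
    unfolding forest_labels_def
    using inj(1) wf disj
  proof (induction F)
    case (Cons T F)
    thus ?case by (auto simp: disjoint_iff)
  qed simp
  moreover have "set (forest_labels F) = M"
    using part by (auto simp: partition_on_def set_forest_labels)
  ultimately show "F \<in> kforests k M" using wf sorted by (auto simp: kforests_def)
next
  assume F: "F \<in> kforests k M"
  have dist: "distinct (forest_labels F)" using F by (simp add: kforests_def)
  have "distinct (labels T)" if "T \<in> set F" for T
    using dist that by (auto simp: forest_labels_def distinct_concat_iff)
  moreover have "disjoint ((\<lambda>T. set (labels T)) ` set F)"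
    using dist
  proof (induction F)
    case (Cons T F)
    thus ?case by (auto simp: disjoint_def set_forest_labels)
  qed simp
  hence "partition_on M ((\<lambda>T. set (labels T)) ` set F)"
    using F labels_nonempty by (auto simp: partition_on_def kforests_def set_forest_labels)
  ultimately show "inc_forest k M F"
    using F by (auto simp: inc_forest_def inc_tree_def kforests_def wf_tree_iff)
qed

section \<open>Bijections that remove the minimum\<close>

lemma forest_labels_mset: "mset F = mset G \<Longrightarrow> mset (forest_labels F) = mset (forest_labels G)"
  unfolding forest_labels_def mset_concat map_map
  by (metis mset_map sum_mset_sum_list)

lemma mset_concat_Cons_update:
  "i < length bs \<Longrightarrow> mset (concat (bs[i := t # bs ! i])) = add_mset t (mset (concat bs))"
proof (induction bs arbitrary: i)
  case (Cons b bs)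
  thus ?case by (cases i) auto
qed simp

text \<open>Inserting a tree into the i-th forest changes the concatenation only up to order, and
  label set and distinctness depend on the multiset alone.\<close>

lemma set_forest_labels_update:
  assumes "i < length bs"
  shows "set (forest_labels (concat (bs[i := t # bs ! i]))) =
           set (labels t) \<union> set (forest_labels (concat bs))"
    and "distinct (forest_labels (concat (bs[i := t # bs ! i]))) \<longleftrightarrow>
           distinct (labels t @ forest_labels (concat bs))"
proof -
  have "mset (concat (bs[i := t # bs ! i])) = mset (t # concat bs)"
    using mset_concat_Cons_update[OF assms] by simp
  hence *: "mset (forest_labels (concat (bs[i := t # bs ! i]))) = mset (labels t @ forest_labels (concat bs))"
    by (rule forest_labels_mset[THEN trans]) simp
  show "set (forest_labels (concat (bs[i := t # bs ! i]))) =
           set (labels t) \<union> set (forest_labels (concat bs))"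
    using arg_cong[OF *, of set_mset] by simp
  show "distinct (forest_labels (concat (bs[i := t # bs ! i]))) \<longleftrightarrow>
           distinct (labels t @ forest_labels (concat bs))"
    using * mset_eq_imp_distinct_iff by blast
qed

lemma concat_prune_top [simp]: "concat (prune_top bs) = concat bs"
  by (auto simp: prune_top_def)

text \<open>Only all-empty tuples are changed by \<open>prune_top\<close>, and there is just one of
  them of length k.\<close>

lemma prune_top_inj:
  assumes "length bs = k" "length cs = k" "prune_top bs = prune_top cs"
  shows "bs = cs"
proof (cases "\<forall>b\<in>set bs. b = []")
  case True
  hence "\<forall>c\<in>set cs. c = []" using assms(3) by (auto simp: prune_top_def split: if_splits)
  thus ?thesis using True assms by (metis replicate_length_same)
next
  case False
  thus ?thesis using assms(3) by (auto simp: prune_top_def split: if_splits)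
qed

lemma prune_top_eq_Nil: "prune_top bs = [] \<longleftrightarrow> concat bs = []"
  by (auto simp: prune_top_def)

lemma ktuples_empty: "k \<ge> 1 \<Longrightarrow> ktuples k {} = {replicate k []}"
  by (auto simp: ktuples_def intro!: replicate_eqI)

lemma ktuples_concat_empty: "cs \<in> ktuples k A \<Longrightarrow> concat cs = [] \<longleftrightarrow> A = {}"
  by (auto simp: ktuples_def)

lemma kforests_Nil_iff: "F \<in> kforests k A \<Longrightarrow> F = [] \<longleftrightarrow> A = {}"
  by (auto simp: kforests_def)

lemma kforests_empty: "kforests k {} = {[]}"
  by (auto simp: kforests_def)

lemma wf_tree_Node_prune_top:
  assumes "cs \<in> ktuples k A" "\<forall>a\<in>A. m < a"
  shows "wf_tree k (Node m (prune_top cs))"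
  using assms label_in_labels
  by (force simp: ktuples_def prune_top_def set_forest_labels)

lemma wf_tree_NodeE:
  assumes "wf_tree k (Node m bs)" "distinct (labels (Node m bs))" "k \<ge> 1"
  obtains cs where "cs \<in> ktuples k (set (labels (Node m bs)) - {m})" "bs = prune_top cs"
proof (cases "bs = []")
  case True
  show ?thesis
    by (rule that[of "replicate k []"]) (use True assms(3) in \<open>auto simp: ktuples_empty labels_Node prune_top_def\<close>)
next
  case False
  show ?thesis
    by (rule that[of bs]) (use False assms in \<open>auto simp: ktuples_def labels_Node prune_top_def\<close>)
qed

lemma labels_Node_prune_top:
  "cs \<in> ktuples k A \<Longrightarrow> set (labels (Node m (prune_top cs))) = insert m A"
  "cs \<in> ktuples k A \<Longrightarrow> distinct (labels (Node m (prune_top cs))) \<longleftrightarrow> m \<notin> A"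
  by (auto simp: labels_Node ktuples_def)

text \<open>A root is the minimum of its tree, so sortedness of the roots amounts to the first root
  being the minimum of all of M, a condition that does not mention the other trees.\<close>

lemma kforests_Cons_iff:
  "T # F \<in> kforests k M \<longleftrightarrow>
     wf_tree k T \<and> distinct (labels T) \<and> set (labels T) \<subseteq> M \<and> F \<in> kforests k (M - set (labels T)) \<and>
     (\<forall>l\<in>M. label T \<le> l)" (is "?L \<longleftrightarrow> ?R")
proof
  assume L: ?L
  have "label T \<le> l" if "l \<in> M" for l
  proof -
    obtain S where S: "S \<in> set (T # F)" "l \<in> set (labels S)"
      using L \<open>l \<in> M\<close> by (auto simp: kforests_def set_forest_labels)
    hence "label S \<le> l" using L by (auto simp: kforests_def intro: wf_tree_label_le)
    moreover have "label T \<le> label S" using L S by (auto simp: kforests_def)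
    ultimately show ?thesis by simp
  qed
  thus ?R using L by (auto simp: kforests_def)
next
  assume R: ?R
  have "label T < label S" if "S \<in> set F" for S
  proof -
    have "label S \<in> M - set (labels T)"
      using R that label_in_labels[of S] by (auto simp: kforests_def set_forest_labels)
    thus ?thesis using R label_in_labels[of T] by (metis DiffE nat_less_le)
  qed
  thus ?L using R by (auto simp: kforests_def)
qed

text \<open>The minimum of M is the root of the first tree. What remains is the tuple hanging below
  it, with label set A, and the other trees.\<close>

lemma bij_betw_kforests:
  assumes M: "finite M" "M \<noteq> {}" and k: "k \<ge> 1"
  defines "m \<equiv> Min M" and "N \<equiv> M - {Min M}"
  shows "bij_betw (\<lambda>(A, cs, F). Node m (prune_top cs) # F)
           (SIGMA A:Pow N. ktuples k A \<times> kforests k (N - A)) (kforests k M)"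
proof (rule bij_betwI')
  have m: "m \<in> M" "\<And>a. a \<in> N \<Longrightarrow> m < a" "m \<notin> N" "M = insert m N"
    using Min_in[OF M] Min_le[OF M(1)] by (auto simp: m_def N_def order.strict_iff_order)
  {
    fix p q assume pq: "p \<in> (SIGMA A:Pow N. ktuples k A \<times> kforests k (N - A))"
      "q \<in> (SIGMA A:Pow N. ktuples k A \<times> kforests k (N - A))"
    obtain A cs F B ds G where eq: "p = (A, cs, F)" "q = (B, ds, G)" by (metis prod_cases3)
    show "((case p of (A, cs, F) \<Rightarrow> Node m (prune_top cs) # F) =
           (case q of (A, cs, F) \<Rightarrow> Node m (prune_top cs) # F)) = (p = q)"
      using pq eq prune_top_inj[of cs k ds] by (auto simp: ktuples_def)
  next
    fix p assume "p \<in> (SIGMA A:Pow N. ktuples k A \<times> kforests k (N - A))"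
    then obtain A cs F where p: "p = (A, cs, F)" "A \<subseteq> N" "cs \<in> ktuples k A" "F \<in> kforests k (N - A)"
      by auto
    have "M - insert m A = N - A" using m by auto
    hence "Node m (prune_top cs) # F \<in> kforests k M"
      using p m wf_tree_Node_prune_top[of cs k A m] labels_Node_prune_top[OF p(3), of m]
      by (auto simp: kforests_Cons_iff intro: less_imp_le)
    thus "(case p of (A, cs, F) \<Rightarrow> Node m (prune_top cs) # F) \<in> kforests k M" using p by simp
  next
    fix F assume F: "F \<in> kforests k M"
    then obtain T G where TG: "F = T # G" using M kforests_Nil_iff by (metis list.exhaust)
    obtain l bs where T: "T = Node l bs" by (cases T)
    have *: "wf_tree k T" "distinct (labels T)" "set (labels T) \<subseteq> M" "G \<in> kforests k (M - set (labels T))"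
      "\<forall>l\<in>M. label T \<le> l" using F by (auto simp: TG kforests_Cons_iff)
    have "l = m"
      using * M label_in_labels[of T] unfolding m_def T by (auto intro!: Min_eqI[symmetric])
    obtain cs where cs: "cs \<in> ktuples k (set (labels T) - {m})" "bs = prune_top cs"
      using wf_tree_NodeE[of k l bs] * k \<open>l = m\<close> T by metis
    have "N - (set (labels T) - {m}) = M - set (labels T)"
      using m label_in_labels[of T] T \<open>l = m\<close> by auto
    thus "\<exists>p\<in>(SIGMA A:Pow N. ktuples k A \<times> kforests k (N - A)).
            F = (case p of (A, cs, F) \<Rightarrow> Node m (prune_top cs) # F)"
      using cs * m by (intro bexI[of _ "(set (labels T) - {m}, cs, G)"]) (auto simp: TG T \<open>l = m\<close>)
  }
qed

text \<open>The minimum is the first root in exactly one of the k forests; the index i says in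
  which, and is the origin of the factor k in the equations for tuples.\<close>

lemma bij_betw_ktuples:
  assumes M: "finite M" "M \<noteq> {}" and k: "k \<ge> 1"
  defines "m \<equiv> Min M" and "N \<equiv> M - {Min M}"
  shows "bij_betw (\<lambda>(i, A, cs, bs). bs[i := Node m (prune_top cs) # bs ! i])
           ({..<k} \<times> (SIGMA A:Pow N. ktuples k A \<times> ktuples k (N - A))) (ktuples k M)"
    (is "bij_betw ?f ?D _")
proof (rule bij_betwI')
  have m: "m \<in> M" "\<And>a. a \<in> N \<Longrightarrow> m < a" "m \<notin> N" "M = insert m N"
    using Min_in[OF M] Min_le[OF M(1)] by (auto simp: m_def N_def order.strict_iff_order)
  have notin: "m \<noteq> label t" if "bs \<in> ktuples k B" "B \<subseteq> N" "b \<in> set bs" "t \<in> set b" for bs B b t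
    using that m(3) label_in_labels[of t] by (auto simp: ktuples_def set_forest_labels)
  {
    fix p q assume pq: "p \<in> ?D" "q \<in> ?D"
    obtain i A cs bs where p: "p = (i, A, cs, bs)" by (metis prod_cases4)
    obtain j B ds es where q: "q = (j, B, ds, es)" by (metis prod_cases4)
    have mem: "i < k" "j < k" "cs \<in> ktuples k A" "ds \<in> ktuples k B" "A \<subseteq> N" "B \<subseteq> N"
      "bs \<in> ktuples k (N - A)" "es \<in> ktuples k (N - B)" using pq p q by auto
    have len: "length cs = k" "length ds = k" "length bs = k" "length es = k"
      using mem by (auto simp: ktuples_def)
    have "p = q" if eq: "bs[i := Node m (prune_top cs) # bs ! i] = es[j := Node m (prune_top ds) # es ! j]"
    proof -
      \<comment> \<open>Otherwise \<open>es\<close> would already contain a root labelled m, but its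
        labels lie in N.\<close>
      have ij: "i = j"
      proof (rule ccontr)
        assume "i \<noteq> j"
        hence "es ! i = Node m (prune_top cs) # bs ! i"
          using arg_cong[OF eq, of "\<lambda>l. l ! i"] mem len by simp
        moreover have "es ! i \<in> set es" using mem len by simp
        ultimately show False using notin[OF mem(8), of "es ! i" "Node m (prune_top cs)"] by auto
      qed
      have "Node m (prune_top cs) # bs ! i = Node m (prune_top ds) # es ! i"
        using arg_cong[OF eq, of "\<lambda>l. l ! i"] mem len ij by simp
      hence 1: "cs = ds" "bs ! i = es ! i" using prune_top_inj[of cs k ds] len by auto
      have "bs = es"
      proof (rule nth_equalityI)
        fix l assume "l < length bs"
        thus "bs ! l = es ! l" using arg_cong[OF eq, of "\<lambda>x. x ! l"] 1 ij len mem by (cases "l = i") auto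
      qed (simp add: len)
      thus ?thesis using ij 1 p q mem by (auto simp: ktuples_def)
    qed
    thus "(?f p = ?f q) = (p = q)" using p q by auto
  next
    fix p assume "p \<in> ?D"
    then obtain i A cs bs where p: "p = (i, A, cs, bs)" "i < k" "A \<subseteq> N" "cs \<in> ktuples k A"
      "bs \<in> ktuples k (N - A)" by auto
    let ?t = "Node m (prune_top cs)"
    have len: "length bs = k" using p by (auto simp: ktuples_def)
    have t: "wf_tree k ?t" "set (labels ?t) = insert m A" "distinct (labels ?t)"
      using wf_tree_Node_prune_top[OF p(4), of m] labels_Node_prune_top[OF p(4), of m] m p
      by (auto simp del: wf_tree.simps)
    have lt: "m < label u" if "b \<in> set bs" "u \<in> set b" for b u
    proof -
      have "label u \<in> N" using p that label_in_labels[of u] by (auto simp: ktuples_def set_forest_labels)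
      thus ?thesis using m by blast
    qed
    have "bs ! i \<in> set bs" using p len by simp
    hence "sorted_wrt (<) (map label (?t # bs ! i))" "\<forall>u\<in>set (?t # bs ! i). wf_tree k u"
      using p(5) lt t by (auto simp: ktuples_def simp del: wf_tree.simps)
    moreover have "set (bs[i := ?t # bs ! i]) \<subseteq> insert (?t # bs ! i) (set bs)"
      by (rule set_update_subset_insert)
    ultimately have "\<forall>b\<in>set (bs[i := ?t # bs ! i]). (\<forall>u\<in>set b. wf_tree k u) \<and> sorted_wrt (<) (map label b)"
      using p(5) unfolding ktuples_def by blast
    moreover have "distinct (labels ?t @ forest_labels (concat bs))"
      using t p m by (auto simp: ktuples_def)
    ultimately have "bs[i := ?t # bs ! i] \<in> ktuples k M"
      using p(5) len p(2,3) t(2) m(4) unfolding ktuples_def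
      by (simp add: set_forest_labels_update) blast
    thus "?f p \<in> ktuples k M" using p by simp
  next
    fix es assume es: "es \<in> ktuples k M"
    then obtain b t where b: "b \<in> set es" "t \<in> set b" "m \<in> set (labels t)"
      using m(1) by (auto simp: ktuples_def set_forest_labels)
    then obtain i where i: "i < k" "es ! i = b" using es by (auto simp: ktuples_def in_set_conv_nth)
    have len: "length es = k" using es by (simp add: ktuples_def)
    have wf: "\<forall>t\<in>set b. wf_tree k t" "sorted_wrt (<) (map label b)" using es b by (auto simp: ktuples_def)
    obtain h r where hr: "b = h # r" using b(2) by (cases b) auto
    have "label h \<in> M" using b hr es label_in_labels[of h] by (force simp: ktuples_def set_forest_labels)
    hence "m \<le> label h" using M by (simp add: m_def)
    moreover have "label h \<le> label t" using wf hr b by auto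
    moreover have "label t \<le> m" using wf_tree_label_le wf b by blast
    ultimately have "label h = m" by simp
    then obtain cs' where h: "h = Node m cs'" by (cases h) auto
    define bs where "bs = es[i := r]"
    have es_eq: "es = bs[i := h # bs ! i]" using len i hr by (simp add: bs_def) (metis list_update_id)
    have lenbs: "length bs = k" using len by (simp add: bs_def)
    have D: "distinct (labels h @ forest_labels (concat bs))"
      and S: "M = set (labels h) \<union> set (forest_labels (concat bs))"
      using es set_forest_labels_update[of i bs h] lenbs i es_eq unfolding ktuples_def by auto
    obtain cs where cs: "cs \<in> ktuples k (set (labels h) - {m})" "cs' = prune_top cs"
      using wf_tree_NodeE[of k m cs'] D wf hr h k by auto
    have mh: "m \<in> set (labels h)" using label_in_labels[of h] h by simp
    have A: "set (labels h) - {m} \<subseteq> N" "N - (set (labels h) - {m}) = set (forest_labels (concat bs))"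
      using S D mh by (auto simp: N_def m_def)
    have "set bs \<subseteq> insert r (set es)" unfolding bs_def by (rule set_update_subset_insert)
    hence "bs \<in> ktuples k (set (forest_labels (concat bs)))"
      using es wf hr lenbs D unfolding ktuples_def by auto
    thus "\<exists>p\<in>?D. es = ?f p"
      using es_eq h cs A i
      by (intro bexI[of _ "(i, set (labels h) - {m}, cs, bs)"]) auto
  }
qed


section \<open>Leaf statistics and weighted sums\<close>

definition inner_leaves :: "tree \<Rightarrow> nat" where
  "inner_leaves T = lleaf (concat (children T))"

definition nonroot_leaves :: "tree list \<Rightarrow> nat" where
  "nonroot_leaves F = sum_list (map inner_leaves F)"

fun young_free_tree :: "tree \<Rightarrow> bool" where
  "young_free_tree (Node m bs) \<longleftrightarrow> (\<forall>b\<in>set bs. \<forall>t\<in>set b. young_free_tree t \<and>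
     (children t = [] \<longrightarrow> (\<forall>b'\<in>set bs. \<forall>t'\<in>set b'. label t' \<le> label t)))"

text \<open>Here G is read as the list of all grand children of one node, so its members compete
  with each other for being old.\<close>

definition young_free :: "tree list \<Rightarrow> bool" where
  "young_free G \<longleftrightarrow> (\<forall>t\<in>set G. young_free_tree t \<and> (leaf t \<longrightarrow> (\<forall>t'\<in>set G. label t' \<le> label t)))"

definition first_empty :: "nat \<Rightarrow> 'a list list \<Rightarrow> bool" where
  "first_empty k bs \<longleftrightarrow> (\<forall>b\<in>set (take (k - 1) bs). b = [])"

text \<open>Removability as it looks in a tree without young leaves: there a leaf among the grand
  children of the root is automatically the greatest and the only one, so existence suffices. The
  case \<open>F = []\<close> is the last tree, which has no next root to compare with.\<close>

definition top_removable :: "nat \<Rightarrow> tree list list \<Rightarrow> tree list \<Rightarrow> bool" where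
  "top_removable k bs F \<longleftrightarrow>
     first_empty k bs \<and> (\<exists>u\<in>set (concat bs). leaf u \<and> (F = [] \<or> label u < label (hd F)))"

definition ksum :: "nat \<Rightarrow> (tree list list \<Rightarrow> real) \<Rightarrow> nat set \<Rightarrow> real" where
  "ksum k g A = (\<Sum>cs\<in>ktuples k A. g cs)"

definition fsum :: "nat \<Rightarrow> (tree list \<Rightarrow> real) \<Rightarrow> nat set \<Rightarrow> real" where
  "fsum k h A = (\<Sum>F\<in>kforests k A. h F)"

definition yf_weight :: "real \<Rightarrow> tree list \<Rightarrow> real" where
  "yf_weight y G = (if young_free G then y ^ lleaf G else 0)"

lemma inner_leaves_Node [simp]: "inner_leaves (Node m bs) = lleaf (concat bs)"
  by (simp add: inner_leaves_def)

lemma nonroot_leaves_simps [simp]: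
  "nonroot_leaves [] = 0" "nonroot_leaves (T # F) = inner_leaves T + nonroot_leaves F"
  by (simp_all add: nonroot_leaves_def)

lemma lleaf_Nil [simp]: "lleaf [] = 0"
  by (simp add: lleaf_def)

lemma lleaf_Cons: "lleaf (T # F) = (if leaf T then 1 else 0) + inner_leaves T + lleaf F"
  by (cases T) (simp add: lleaf_def nodes_eq)

lemma leaf_Node [simp]: "leaf (Node m bs) \<longleftrightarrow> bs = []"
  by (simp add: leaf_def)

text \<open>A root is a leaf exactly when its tree is a singleton, so subtracting \<open>si\<close>
  removes the roots from the count.\<close>

lemma lleaf_minus_si: "lleaf F - si F = nonroot_leaves F"
proof -
  have "lleaf F = si F + nonroot_leaves F"
    by (induction F) (auto simp: lleaf_Cons si_def singleton_def leaf_def)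
  thus ?thesis by simp
qed

lemma lleaf_mset: "mset F = mset G \<Longrightarrow> lleaf F = lleaf G"
proof -
  assume *: "mset F = mset G"
  have "lleaf F = sum_list (map (\<lambda>T. lleaf [T]) F)" for F
    by (induction F) (auto simp: lleaf_Cons)
  thus ?thesis using * by (metis mset_map sum_mset_sum_list)
qed

lemma young_free_tree_iff: "young_free_tree T \<longleftrightarrow> young_free (concat (children T))"
  by (cases T) (auto simp: young_free_def leaf_def)

declare young_free_tree.simps [simp del]

text \<open>T has the smallest label, so as a leaf it must have no siblings.\<close>

lemma young_free_Cons:
  assumes "\<forall>t\<in>set G. label T < label t"
  shows "young_free (T # G) \<longleftrightarrow> young_free_tree T \<and> (leaf T \<longrightarrow> G = []) \<and> young_free G"
  using assms unfolding young_free_def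
  by (auto simp: less_imp_le) (metis leD list.set_intros(1) neq_Nil_conv)

lemma young_free_mset: "mset F = mset G \<Longrightarrow> young_free F \<longleftrightarrow> young_free G"
  using mset_eq_setD[of F G] by (simp add: young_free_def)

lemma young_free_Nil [simp]: "young_free []"
  by (simp add: young_free_def)

lemma first_empty_prune_top [simp]: "first_empty k (prune_top cs) \<longleftrightarrow> first_empty k cs"
  by (auto simp: first_empty_def prune_top_def dest: in_set_takeD)

lemma top_removable_prune_top [simp]: "top_removable k (prune_top cs) F \<longleftrightarrow> top_removable k cs F"
  unfolding top_removable_def concat_prune_top by simp

section \<open>Finiteness and recursions for weighted sums\<close>

lemma finite_ktuples:
  assumes "k \<ge> 1" "finite M"
  shows "finite (ktuples k M)"
  using assms(2)
proof (induction M rule: measure_induct_rule[of card])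
  case (less M)
  show ?case
  proof (cases "M = {}")
    case True
    thus ?thesis using assms by (simp add: ktuples_empty)
  next
    case False
    let ?N = "M - {Min M}"
    have "finite (ktuples k A)" if "A \<subseteq> ?N" for A
      using less that False Min_in[of M] psubset_card_mono[of M A] by (metis Diff_subset Diff_iff finite_subset insertI1 psubsetI subset_iff)
    hence "finite ({..<k} \<times> (SIGMA A:Pow ?N. ktuples k A \<times> ktuples k (?N - A)))"
      using less.prems by (intro finite_cartesian_product finite_SigmaI) auto
    thus ?thesis using bij_betw_finite[OF bij_betw_ktuples[OF less.prems False assms(1)]] by simp
  qed
qed

lemma finite_kforests:
  assumes "k \<ge> 1" "finite M"
  shows "finite (kforests k M)"
  using assms(2)
proof (induction M rule: measure_induct_rule[of card])
  case (less M)
  show ?case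
  proof (cases "M = {}")
    case True
    thus ?thesis by (simp add: kforests_empty)
  next
    case False
    let ?N = "M - {Min M}"
    have "finite (kforests k A)" if "A \<subseteq> ?N" for A
      using less that False Min_in[of M] psubset_card_mono[of M A] by (metis Diff_subset Diff_iff finite_subset insertI1 psubsetI subset_iff)
    hence "finite (SIGMA A:Pow ?N. ktuples k A \<times> kforests k (?N - A))"
      using less.prems assms(1) by (intro finite_cartesian_product finite_SigmaI finite_ktuples) (auto intro: finite_subset)
    thus ?thesis using bij_betw_finite[OF bij_betw_kforests[OF less.prems False assms(1)]] by simp
  qed
qed

lemma fsum_rec:
  assumes M: "finite M" "M \<noteq> {}" and k: "k \<ge> 1"
  shows "fsum k f M = (\<Sum>A\<in>Pow (M - {Min M}). \<Sum>cs\<in>ktuples k A.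
           \<Sum>F\<in>kforests k (M - {Min M} - A). f (Node (Min M) (prune_top cs) # F))"
proof -
  have fin: "finite A" if "A \<in> Pow (M - {Min M})" for A using that M finite_subset by auto
  show ?thesis
    unfolding fsum_def sum.reindex_bij_betw[OF bij_betw_kforests[OF M k], symmetric] sum.cartesian_product
    using M fin finite_ktuples[OF k] finite_kforests[OF k]
    by (subst sum.Sigma) (auto simp: case_prod_unfold)
qed

lemma ksum_rec:
  assumes M: "finite M" "M \<noteq> {}" and k: "k \<ge> 1"
  shows "ksum k f M = (\<Sum>i<k. \<Sum>A\<in>Pow (M - {Min M}). \<Sum>cs\<in>ktuples k A.
           \<Sum>bs\<in>ktuples k (M - {Min M} - A). f (bs[i := Node (Min M) (prune_top cs) # bs ! i]))"
proof -
  have fin: "finite A" if "A \<in> Pow (M - {Min M})" for A using that M finite_subset by auto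
  let ?D = "SIGMA A:Pow (M - {Min M}). ktuples k A \<times> ktuples k (M - {Min M} - A)"
  have "ksum k f M = (\<Sum>i<k. \<Sum>(A, cs, bs)\<in>?D. f (bs[i := Node (Min M) (prune_top cs) # bs ! i]))"
    unfolding ksum_def sum.reindex_bij_betw[OF bij_betw_ktuples[OF M k], symmetric]
    by (simp add: case_prod_unfold sum.cartesian_product)
  moreover have "(\<Sum>(A, cs, bs)\<in>?D. f (bs[i := Node (Min M) (prune_top cs) # bs ! i])) =
      (\<Sum>A\<in>Pow (M - {Min M}). \<Sum>cs\<in>ktuples k A.
           \<Sum>bs\<in>ktuples k (M - {Min M} - A). f (bs[i := Node (Min M) (prune_top cs) # bs ! i]))" for i
    unfolding sum.cartesian_product
    using M fin finite_ktuples[OF k]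
    by (subst sum.Sigma) (auto simp: case_prod_unfold)
  ultimately show ?thesis by simp
qed

lemma sum_Pow_delta:
  fixes c :: "nat set \<Rightarrow> real"
  assumes "finite N"
  shows "(\<Sum>A\<in>Pow N. if A = {} then c A else 0) = c {}"
    and "(\<Sum>A\<in>Pow N. if A = N then c A else 0) = c N"
  using assms by (auto simp: sum.delta)

lemma kforests_label_in: "F \<in> kforests k B \<Longrightarrow> t \<in> set F \<Longrightarrow> label t \<in> B"
  using label_in_labels[of t] by (auto simp: kforests_def set_forest_labels)

lemma ktuples_label_in: "cs \<in> ktuples k B \<Longrightarrow> t \<in> set (concat cs) \<Longrightarrow> label t \<in> B"
  using label_in_labels[of t] by (auto simp: ktuples_def set_forest_labels)

text \<open>Common shape of all forest recursions: a weight of the first tree times a weight of the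
  rest, plus a term \<open>l\<close> for a forest with a single tree. That term occurs only when A
  is the whole remaining label set.\<close>

lemma fsum_step:
  assumes M: "finite M" "M \<noteq> {}" and k: "k \<ge> 1"
    and step: "\<And>m A B cs F. cs \<in> ktuples k A \<Longrightarrow> F \<in> kforests k B \<Longrightarrow> \<forall>a\<in>A \<union> B. m < a \<Longrightarrow>
      f (Node m (prune_top cs) # F) = g cs * h F + (if F = [] then l cs else 0)"
  shows "fsum k f M = conv (ksum k g) (fsum k h) (M - {Min M}) + ksum k l (M - {Min M})"
proof -
  let ?N = "M - {Min M}"
  have lt: "Min M < a" if "a \<in> ?N" for a
    using that Min_le[OF M(1), of a] by (auto simp: order.strict_iff_order)
  have "fsum k f M = (\<Sum>A\<in>Pow ?N. ksum k g A * fsum k h (?N - A) + (if A = ?N then ksum k l A else 0))"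
    unfolding fsum_rec[OF M k]
  proof (rule sum.cong[OF refl])
    fix A assume A: "A \<in> Pow ?N"
    have fin: "finite (kforests k (?N - A))" using M finite_kforests[OF k] by simp
    have "(\<Sum>cs\<in>ktuples k A. \<Sum>F\<in>kforests k (?N - A). f (Node (Min M) (prune_top cs) # F)) =
      (\<Sum>cs\<in>ktuples k A. \<Sum>F\<in>kforests k (?N - A). g cs * h F + (if A = ?N then l cs else 0))"
    proof (intro sum.cong refl)
      fix cs F assume *: "cs \<in> ktuples k A" "F \<in> kforests k (?N - A)"
      have "F = [] \<longleftrightarrow> A = ?N" using kforests_Nil_iff[OF *(2)] A by auto
      moreover have "\<forall>a\<in>A \<union> (?N - A). Min M < a" using lt A by blast
      ultimately show "f (Node (Min M) (prune_top cs) # F) = g cs * h F + (if A = ?N then l cs else 0)"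
        using step[OF *, of "Min M"] by presburger
    qed
    also have "\<dots> = ksum k g A * fsum k h (?N - A) + (if A = ?N then ksum k l A else 0)"
      by (cases "A = ?N")
         (simp_all add: ksum_def fsum_def sum.distrib kforests_empty
           sum_distrib_left[symmetric] sum_distrib_right[symmetric])
    finally show "(\<Sum>cs\<in>ktuples k A. \<Sum>F\<in>kforests k (?N - A). f (Node (Min M) (prune_top cs) # F)) =
      ksum k g A * fsum k h (?N - A) + (if A = ?N then ksum k l A else 0)" .
  qed
  thus ?thesis using sum_Pow_delta(2)[of ?N "ksum k l"] M
    by (simp add: sum.distrib conv_def)
qed

lemma conv_empty: "finite M \<Longrightarrow> conv (\<lambda>A. if A = {} then c else 0) R M = c * R M"
  using sum_Pow_delta(1)[of M "\<lambda>A. c * R (M - A)"]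
  by (simp add: conv_def if_distrib[of "\<lambda>a. a * _"] cong: if_cong)

text \<open>The weight sees only the multiset of trees, so the position of the new tree does not
  matter and the sum over positions becomes the factor k. The constant c corrects the case of a
  single label.\<close>

lemma ksum_step:
  assumes M: "finite M" "M \<noteq> {}" and k: "k \<ge> 1"
    and mset: "\<And>F G. mset F = mset G \<Longrightarrow> f F = f G"
    and step: "\<And>m A B cs bs. cs \<in> ktuples k A \<Longrightarrow> bs \<in> ktuples k B \<Longrightarrow> \<forall>a\<in>A \<union> B. m < a \<Longrightarrow>
      f (Node m (prune_top cs) # concat bs) = g cs * h bs + (if A = {} \<and> B = {} then c else 0)"
  shows "ksum k (\<lambda>cs. f (concat cs)) M =
    real k * (conv (ksum k g) (ksum k h) (M - {Min M}) + (if M - {Min M} = {} then c else 0))"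
proof -
  let ?N = "M - {Min M}"
  have lt: "Min M < a" if "a \<in> ?N" for a
    using that Min_le[OF M(1), of a] by (auto simp: order.strict_iff_order)
  have "ksum k (\<lambda>cs. f (concat cs)) M =
    (\<Sum>i<k. \<Sum>A\<in>Pow ?N. ksum k g A * ksum k h (?N - A) + (if A = {} then if ?N = {} then c else 0 else 0))"
    unfolding ksum_rec[OF M k]
  proof (intro sum.cong[OF refl])
    fix i A assume i: "i \<in> {..<k}" and A: "A \<in> Pow ?N"
    have "(\<Sum>cs\<in>ktuples k A. \<Sum>bs\<in>ktuples k (?N - A).
         f (concat (bs[i := Node (Min M) (prune_top cs) # bs ! i]))) =
      (\<Sum>cs\<in>ktuples k A. \<Sum>bs\<in>ktuples k (?N - A). g cs * h bs + (if ?N = {} then c else 0))"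
    proof (intro sum.cong refl)
      fix cs bs assume *: "cs \<in> ktuples k A" "bs \<in> ktuples k (?N - A)"
      have "i < length bs" using i * by (auto simp: ktuples_def)
      hence "f (concat (bs[i := Node (Min M) (prune_top cs) # bs ! i])) =
          f (Node (Min M) (prune_top cs) # concat bs)"
        by (intro mset) (simp add: mset_concat_Cons_update)
      also have "\<dots> = g cs * h bs + (if A = {} \<and> ?N - A = {} then c else 0)"
        using step[OF *, of "Min M"] lt A by blast
      also have "(A = {} \<and> ?N - A = {}) = (?N = {})" using A by auto
      finally show "f (concat (bs[i := Node (Min M) (prune_top cs) # bs ! i])) =
        g cs * h bs + (if ?N = {} then c else 0)" .
    qed
    also have "\<dots> = ksum k g A * ksum k h (?N - A) + (if A = {} then if ?N = {} then c else 0 else 0)"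
    proof (cases "?N = {}")
      case True
      hence "A = {}" using A by auto
      show ?thesis unfolding True \<open>A = {}\<close>
        using k by (simp add: ksum_def sum_product sum.distrib ktuples_empty)
    qed (simp add: ksum_def sum_product sum.distrib)
    finally show "(\<Sum>cs\<in>ktuples k A. \<Sum>bs\<in>ktuples k (?N - A).
         f (concat (bs[i := Node (Min M) (prune_top cs) # bs ! i]))) =
      ksum k g A * ksum k h (?N - A) + (if A = {} then if ?N = {} then c else 0 else 0)" .
  qed
  thus ?thesis using sum_Pow_delta(1)[of ?N "\<lambda>_. if ?N = {} then c else 0"] M
    by (simp add: sum.distrib conv_def)
qed

text \<open>Such a tuple is determined by its last entry; thus the condition on the first k - 1
  children turns sums over tuples into sums over forests.\<close>

lemma bij_betw_first_empty:
  assumes k: "k \<ge> 1"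
  shows "bij_betw (\<lambda>b. replicate (k - 1) [] @ [b]) (kforests k A) {cs \<in> ktuples k A. first_empty k cs}"
proof (rule bij_betwI')
  fix cs assume cs: "cs \<in> {cs \<in> ktuples k A. first_empty k cs}"
  hence len: "length cs = k" by (simp add: ktuples_def)
  have "take (k - 1) cs = replicate (k - 1) []"
    using cs len by (intro replicate_eqI) (auto simp: first_empty_def)
  moreover have "drop (k - 1) cs = [last cs]"
    using len k by (cases cs rule: rev_cases) auto
  ultimately have eq: "cs = replicate (k - 1) [] @ [last cs]"
    by (metis append_take_drop_id)
  have "last cs \<in> set cs" using len k by (intro last_in_set) auto
  moreover have "concat cs = last cs" by (subst eq) simp
  ultimately have "last cs \<in> kforests k A" using cs by (auto simp: ktuples_def kforests_def)
  thus "\<exists>b\<in>kforests k A. cs = replicate (k - 1) [] @ [b]" using eq by blast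
next
  fix b assume "b \<in> kforests k A"
  thus "replicate (k - 1) [] @ [b] \<in> {cs \<in> ktuples k A. first_empty k cs}"
    using k by (auto simp: ktuples_def kforests_def first_empty_def)
qed auto

lemma ksum_first_empty:
  assumes k: "k \<ge> 1" and "finite A"
  shows "ksum k (\<lambda>cs. if first_empty k cs then f (concat cs) else 0) A = fsum k f A"
proof -
  have "ksum k (\<lambda>cs. if first_empty k cs then f (concat cs) else 0) A =
      (\<Sum>cs\<in>{cs \<in> ktuples k A. first_empty k cs}. f (concat cs))"
    unfolding ksum_def using finite_ktuples[OF k] assms by (simp add: sum.inter_filter)
  also have "\<dots> = (\<Sum>b\<in>kforests k A. f (concat (replicate (k - 1) [] @ [b])))"
    by (rule sum.reindex_bij_betw[OF bij_betw_first_empty[OF k], symmetric])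
  finally show ?thesis by (simp add: fsum_def)
qed


section \<open>Differential equations for the basic classes\<close>

lemma card_inv_step:
  assumes "min_rec S S'"
    and "\<And>n. card_inv_below n S \<Longrightarrow> card_inv_below n S'"
  shows "card_inv S"
proof -
  have "card_inv_below n S" for n
    by (induction n) (use assms card_inv_below_Suc card_inv_below_0 in blast)+
  thus ?thesis by (simp add: card_inv_def)
qed

lemma card_inv_intros:
  "card_inv P \<Longrightarrow> card_inv R \<Longrightarrow> card_inv (conv P R)"
  "card_inv P \<Longrightarrow> card_inv R \<Longrightarrow> card_inv (\<lambda>M. P M + R M)"
  "card_inv P \<Longrightarrow> card_inv R \<Longrightarrow> card_inv (\<lambda>M. P M - R M)"
  "card_inv P \<Longrightarrow> card_inv (\<lambda>M. c * P M)"
  "card_inv (\<lambda>M. if M = {} then c else 0)"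
  by (simp_all add: card_inv_def card_inv_below_intros)

lemma card_inv_imp_below: "card_inv P \<Longrightarrow> card_inv_below n P"
  by (simp add: card_inv_def)

text \<open>Only the all-empty tuple has empty label set, so giving a leaf another weight alters a
  series in its constant term alone.\<close>

lemma ksum_if_empty:
  assumes "k \<ge> 1"
  shows "ksum k (\<lambda>cs. if concat cs = [] then c else f cs) = (\<lambda>A. if A = {} then c else ksum k f A)"
proof
  fix A
  have "ksum k (\<lambda>cs. if concat cs = [] then c else f cs) A = ksum k (\<lambda>cs. if A = {} then c else f cs) A"
    unfolding ksum_def by (intro sum.cong refl) (auto simp only: ktuples_concat_empty)
  thus "ksum k (\<lambda>cs. if concat cs = [] then c else f cs) A = (if A = {} then c else ksum k f A)"
    using assms by (simp add: ksum_def ktuples_empty)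
qed

lemma ksum_zero [simp]: "ksum k (\<lambda>cs. 0) = (\<lambda>A. 0)"
  by (rule ext) (simp add: ksum_def)

lemma ksum_delta:
  "k \<ge> 1 \<Longrightarrow> ksum k (\<lambda>cs. if concat cs = [] then c else 0) = (\<lambda>A. if A = {} then c else 0)"
  using ksum_if_empty[of k c "\<lambda>_. 0"] by (simp del: concat_eq_Nil_conv cong: if_cong)

lemma fsum_empty [simp]: "fsum k f {} = f []"
  by (simp add: fsum_def kforests_empty)

lemma ksum_empty: "k \<ge> 1 \<Longrightarrow> ksum k f {} = f (replicate k [])"
  by (simp add: ksum_def ktuples_empty)

section \<open>Series of tuples\<close>

text \<open>Its generating function is U of the overview; \<open>yf_tuples\<close> has V.\<close>

definition all_tuples :: "nat \<Rightarrow> real \<Rightarrow> nat set \<Rightarrow> real" where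
  "all_tuples k x = ksum k (\<lambda>cs. x ^ lleaf (concat cs))"

definition yf_tuples :: "nat \<Rightarrow> real \<Rightarrow> nat set \<Rightarrow> real" where
  "yf_tuples k y = ksum k (\<lambda>cs. yf_weight y (concat cs))"

lemma lleaf_Node_prune_top:
  "lleaf (Node m (prune_top cs) # F) = (if concat cs = [] then 1 else 0) + lleaf (concat cs) + lleaf F"
  by (simp only: lleaf_Cons leaf_Node inner_leaves_Node prune_top_eq_Nil concat_prune_top)

lemma yf_weight_Node_prune_top:
  assumes "\<forall>t\<in>set F. m < label t"
  shows "yf_weight y (Node m (prune_top cs) # F) =
    (if concat cs = [] then if F = [] then y else 0 else yf_weight y (concat cs) * yf_weight y F)"
  using assms unfolding yf_weight_def
  by (subst young_free_Cons) (auto simp: young_free_tree_iff lleaf_Node_prune_top prune_top_eq_Nil power_add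
       simp del: concat_eq_Nil_conv)

lemma yf_weight_mset: "mset F = mset G \<Longrightarrow> yf_weight y F = yf_weight y G"
  using lleaf_mset[of F G] young_free_mset[of F G] by (simp add: yf_weight_def)

lemma power_lleaf_mset: "mset F = mset G \<Longrightarrow> x ^ lleaf F = (x :: real) ^ lleaf G"
  using lleaf_mset[of F G] by simp

text \<open>The new node is counted when it is a leaf: the all-empty tuple below it has weight x
  instead of 1, whence the correction x - 1.\<close>

lemma all_tuples_step:
  assumes "k \<ge> 1"
  shows "min_rec (all_tuples k x) (\<lambda>N. real k *
           conv (\<lambda>A. all_tuples k x A + (if A = {} then x - 1 else 0)) (all_tuples k x) N)"
proof (rule min_recI)
  fix M :: "nat set" assume M: "finite M" "M \<noteq> {}"
  have "ksum k (\<lambda>cs. if concat cs = [] then x else x ^ lleaf (concat cs)) =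
      (\<lambda>A. all_tuples k x A + (if A = {} then x - 1 else 0))"
    using assms(1) by (auto simp: ksum_if_empty all_tuples_def ksum_empty simp del: concat_eq_Nil_conv)
  moreover have "ksum k (\<lambda>cs. x ^ lleaf (concat cs)) M = real k * (conv
      (ksum k (\<lambda>cs. if concat cs = [] then x else x ^ lleaf (concat cs)))
      (ksum k (\<lambda>bs. x ^ lleaf (concat bs))) (M - {Min M}) + (if M - {Min M} = {} then 0 else 0))"
    by (intro ksum_step[OF M assms] power_lleaf_mset)
       (simp_all add: lleaf_Node_prune_top power_add del: concat_eq_Nil_conv)
  ultimately show "all_tuples k x M = real k *
      conv (\<lambda>A. all_tuples k x A + (if A = {} then x - 1 else 0)) (all_tuples k x) (M - {Min M})"
    by (simp add: all_tuples_def del: concat_eq_Nil_conv)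
qed

lemma yf_tuples_minus_empty:
  assumes "k \<ge> 1"
  shows "ksum k (\<lambda>cs. if concat cs = [] then 0 else yf_weight y (concat cs)) =
      (\<lambda>A. yf_tuples k y A - (if A = {} then 1 else 0))"
  using assms by (auto simp: ksum_if_empty yf_tuples_def ksum_empty yf_weight_def simp del: concat_eq_Nil_conv)

text \<open>The new node has the smallest label, so as a leaf it tolerates no siblings. The
  all-empty tuple below it gets weight 0, and the structure with one node contributes y
  separately.\<close>

lemma yf_tuples_step:
  assumes "k \<ge> 1"
  shows "min_rec (yf_tuples k y) (\<lambda>N. real k *
           (conv (\<lambda>A. yf_tuples k y A - (if A = {} then 1 else 0)) (yf_tuples k y) N +
            (if N = {} then y else 0)))"
proof (rule min_recI)
  fix M :: "nat set" assume M: "finite M" "M \<noteq> {}"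
  have "yf_weight y (Node m (prune_top cs) # concat bs) =
      (if concat cs = [] then 0 else yf_weight y (concat cs)) * yf_weight y (concat bs) +
      (if A = {} \<and> B = {} then y else 0)"
    if "cs \<in> ktuples k A" "bs \<in> ktuples k B" "\<forall>a\<in>A \<union> B. m < a" for m A B cs bs
    using that yf_weight_Node_prune_top[of "concat bs" m y cs]
      ktuples_concat_empty[OF that(1)] ktuples_concat_empty[OF that(2)] ktuples_label_in[OF that(2)]
    by (auto simp del: concat_eq_Nil_conv simp: yf_weight_def)
  hence "ksum k (\<lambda>cs. yf_weight y (concat cs)) M = real k * (conv
      (ksum k (\<lambda>cs. if concat cs = [] then 0 else yf_weight y (concat cs)))
      (ksum k (\<lambda>bs. yf_weight y (concat bs))) (M - {Min M}) + (if M - {Min M} = {} then y else 0))"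
    by (intro ksum_step[OF M assms] yf_weight_mset)
  thus "yf_tuples k y M = real k *
      (conv (\<lambda>A. yf_tuples k y A - (if A = {} then 1 else 0)) (yf_tuples k y) (M - {Min M}) +
       (if M - {Min M} = {} then y else 0))"
    unfolding yf_tuples_minus_empty[OF assms] by (simp only: yf_tuples_def)
qed

lemma card_inv_all_tuples: "k \<ge> 1 \<Longrightarrow> card_inv (all_tuples k x)"
  by (rule card_inv_step[OF all_tuples_step]) (auto intro!: card_inv_below_intros)

lemma card_inv_yf_tuples: "k \<ge> 1 \<Longrightarrow> card_inv (yf_tuples k y)"
  by (rule card_inv_step[OF yf_tuples_step]) (auto intro!: card_inv_below_intros)

lemma egf_all_tuples:
  assumes "k \<ge> 1"
  shows "fps_deriv (egf (all_tuples k x)) =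
           fps_const (real k) * ((egf (all_tuples k x) + fps_const (x - 1)) * egf (all_tuples k x))"
    and "egf (all_tuples k x) $ 0 = 1"
proof -
  show "fps_deriv (egf (all_tuples k x)) =
           fps_const (real k) * ((egf (all_tuples k x) + fps_const (x - 1)) * egf (all_tuples k x))"
    using card_inv_all_tuples[OF assms]
    by (subst fps_deriv_egf[OF all_tuples_step[OF assms]]) (simp_all add: egf_simps card_inv_intros)
qed (use assms in \<open>simp add: egf_nth_0 all_tuples_def ksum_empty\<close>)

lemma egf_yf_tuples:
  assumes "k \<ge> 1"
  shows "fps_deriv (egf (yf_tuples k y)) =
           fps_const (real k) * ((egf (yf_tuples k y) - 1) * egf (yf_tuples k y) + fps_const y)"
    and "egf (yf_tuples k y) $ 0 = 1"
proof -
  show "fps_deriv (egf (yf_tuples k y)) =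
           fps_const (real k) * ((egf (yf_tuples k y) - 1) * egf (yf_tuples k y) + fps_const y)"
    using card_inv_yf_tuples[OF assms]
    by (subst fps_deriv_egf[OF yf_tuples_step[OF assms]]) (simp_all add: egf_simps card_inv_intros)
qed (use assms in \<open>simp add: egf_nth_0 yf_tuples_def ksum_empty yf_weight_def\<close>)

section \<open>Series of forests\<close>

text \<open>P selects the class by the last tree: \<open>first_empty k\<close> for the first class,
  its negation for the second. With weight 0 on the empty forest, the last tree enters the equations
  as an inhomogeneous term.\<close>

definition last_weight :: "(tree list list \<Rightarrow> bool) \<Rightarrow> real \<Rightarrow> tree list \<Rightarrow> real" where
  "last_weight P x F = (if F \<noteq> [] \<and> P (children (last F)) then x ^ nonroot_leaves F else 0)"

text \<open>Roots are not counted, so a singleton keeps weight 1 and U enters without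
  correction.\<close>

lemma egf_forests:
  fixes x y :: real
  assumes k: "k \<ge> 1"
  defines "S \<equiv> fsum k (\<lambda>F. x ^ nonroot_leaves F)"
  shows "card_inv S" and "fps_deriv (egf S) = egf (all_tuples k x) * egf S" and "egf S $ 0 = 1"
proof -
  have step: "S M = conv (all_tuples k x) S (M - {Min M})" if "finite M" "M \<noteq> {}" for M
    using fsum_step[OF that k, of "\<lambda>F. x ^ nonroot_leaves F"
        "\<lambda>cs. x ^ lleaf (concat cs)" "\<lambda>F. x ^ nonroot_leaves F" "\<lambda>cs. 0"]
    unfolding S_def all_tuples_def by (simp add: power_add)
  from this have step: "min_rec S (\<lambda>N. conv (all_tuples k x) S N)" by (rule min_recI)
  note inv = card_inv_all_tuples[OF k]
  show S: "card_inv S"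
    by (rule card_inv_step[OF step]) (auto intro!: card_inv_below_intros inv[THEN card_inv_imp_below])
  show "fps_deriv (egf S) = egf (all_tuples k x) * egf S"
    by (subst fps_deriv_egf[OF step]) (simp_all add: egf_simps card_inv_intros S inv)
qed (simp add: egf_nth_0 S_def)

text \<open>These forests hang below a root, so their own roots count as leaves. By
  \<open>ksum_first_empty\<close> the series is D of the overview.\<close>

lemma egf_leafy_forests:
  fixes x y :: real
  assumes k: "k \<ge> 1"
  defines "S \<equiv> fsum k (\<lambda>F. x ^ lleaf F)"
  shows "card_inv S" and "fps_deriv (egf S) = (egf (all_tuples k x) + fps_const (x - 1)) * egf S"
    and "egf S $ 0 = 1"
proof -
  have eq: "ksum k (\<lambda>cs. if concat cs = [] then x else x ^ lleaf (concat cs)) =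
      (\<lambda>A. all_tuples k x A + (if A = {} then x - 1 else 0))"
    using assms(1) by (auto simp: ksum_if_empty all_tuples_def ksum_empty simp del: concat_eq_Nil_conv)
  have step: "S M = conv (\<lambda>A. all_tuples k x A + (if A = {} then x - 1 else 0)) S (M - {Min M})"
    if "finite M" "M \<noteq> {}" for M
    using fsum_step[OF that k, of "\<lambda>F. x ^ lleaf F"
        "\<lambda>cs. if concat cs = [] then x else x ^ lleaf (concat cs)" "\<lambda>F. x ^ lleaf F" "\<lambda>cs. 0"]
    unfolding S_def eq by (simp add: lleaf_Node_prune_top power_add del: concat_eq_Nil_conv)
  from this have step: "min_rec S (\<lambda>N. conv (\<lambda>A. all_tuples k x A + (if A = {} then x - 1 else 0)) S N)" by (rule min_recI)
  note inv = card_inv_all_tuples[OF k]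
  show S: "card_inv S"
    by (rule card_inv_step[OF step]) (auto intro!: card_inv_below_intros inv[THEN card_inv_imp_below])
  show "fps_deriv (egf S) = (egf (all_tuples k x) + fps_const (x - 1)) * egf S"
    by (subst fps_deriv_egf[OF step]) (simp_all add: egf_simps card_inv_intros S inv)
qed (simp add: egf_nth_0 S_def)

lemma egf_last:
  fixes x :: real
  assumes k: "k \<ge> 1" and P: "\<And>cs. P (prune_top cs) \<longleftrightarrow> P cs"
  defines "S \<equiv> fsum k (last_weight P x)"
    and "L \<equiv> ksum k (\<lambda>cs. if P cs then x ^ lleaf (concat cs) else 0)"
  assumes L: "card_inv L"
  shows "card_inv S" and "fps_deriv (egf S) = egf (all_tuples k x) * egf S + egf L"
    and "egf S $ 0 = 0"
proof -
  have step: "S M = conv (all_tuples k x) S (M - {Min M}) + L (M - {Min M})"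
    if "finite M" "M \<noteq> {}" for M
    using fsum_step[OF that k, of "last_weight P x"
        "\<lambda>cs. x ^ lleaf (concat cs)" "last_weight P x" "\<lambda>cs. if P cs then x ^ lleaf (concat cs) else 0"]
    unfolding S_def all_tuples_def L_def by (simp add: power_add last_weight_def P)
  from this have step: "min_rec S (\<lambda>N. conv (all_tuples k x) S N + L N)" by (rule min_recI)
  note inv = card_inv_all_tuples[OF k]
  show S: "card_inv S"
    by (rule card_inv_step[OF step]) (auto intro!: card_inv_below_intros inv[THEN card_inv_imp_below] L[THEN card_inv_imp_below])
  show "fps_deriv (egf S) = egf (all_tuples k x) * egf S + egf L"
    by (subst fps_deriv_egf[OF step]) (simp_all add: egf_simps card_inv_intros S inv L)
qed (simp add: egf_nth_0 S_def last_weight_def)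

lemma egf_yf_forests:
  fixes x y :: real
  assumes k: "k \<ge> 1"
  defines "S \<equiv> fsum k (yf_weight y)"
  shows "card_inv S" and "fps_deriv (egf S) = (egf (yf_tuples k y) - 1) * egf S + fps_const y"
    and "egf S $ 0 = 1"
proof -
  have "yf_weight y (Node m (prune_top cs) # F) =
      (if concat cs = [] then 0 else yf_weight y (concat cs)) * yf_weight y F +
      (if F = [] then if concat cs = [] then y else 0 else 0)"
    if "cs \<in> ktuples k A" "F \<in> kforests k B" "\<forall>a\<in>A \<union> B. m < a" for m A B cs F
    using that yf_weight_Node_prune_top[of F m y cs] kforests_label_in[OF that(2)]
    by (auto simp del: concat_eq_Nil_conv simp: yf_weight_def)
  from fsum_step[OF _ _ k, of _ "yf_weight y", OF _ _ this]
  have step: "S M = conv (\<lambda>A. yf_tuples k y A - (if A = {} then 1 else 0)) S (M - {Min M}) +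
      (if M - {Min M} = {} then y else 0)"
    if "finite M" "M \<noteq> {}" for M
    using that unfolding S_def yf_tuples_minus_empty[OF k] ksum_delta[OF k] by simp
  from this have step: "min_rec S (\<lambda>N. conv (\<lambda>A. yf_tuples k y A - (if A = {} then 1 else 0)) S N + (if N = {} then y else 0))" by (rule min_recI)
  note inv = card_inv_yf_tuples[OF k]
  show S: "card_inv S"
    by (rule card_inv_step[OF step]) (auto intro!: card_inv_below_intros inv[THEN card_inv_imp_below])
  show "fps_deriv (egf S) = (egf (yf_tuples k y) - 1) * egf S + fps_const y"
    by (subst fps_deriv_egf[OF step]) (simp_all add: egf_simps card_inv_intros S inv)
qed (simp add: egf_nth_0 S_def yf_weight_def)

text \<open>Arises below the last root in the first class: without a next root, any leaf grand child
  of that root would be removable.\<close>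

definition leafless_weight :: "real \<Rightarrow> tree list \<Rightarrow> real" where
  "leafless_weight y F = (if \<exists>t\<in>set F. leaf t then 0 else yf_weight y F)"

lemma egf_leafless_forests:
  fixes x y :: real
  assumes k: "k \<ge> 1"
  defines "S \<equiv> fsum k (leafless_weight y)"
  shows "card_inv S" and "fps_deriv (egf S) = (egf (yf_tuples k y) - 1) * egf S"
    and "egf S $ 0 = 1"
proof -
  have "leafless_weight y (Node m (prune_top cs) # F) =
      (if concat cs = [] then 0 else yf_weight y (concat cs)) * leafless_weight y F +
      (if F = [] then 0 else 0)"
    if "cs \<in> ktuples k A" "F \<in> kforests k B" "\<forall>a\<in>A \<union> B. m < a" for m A B cs F
    using that yf_weight_Node_prune_top[of F m y cs] kforests_label_in[OF that(2)]
    by (auto simp del: concat_eq_Nil_conv simp: leafless_weight_def prune_top_eq_Nil)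
  from fsum_step[OF _ _ k, of _ "leafless_weight y", OF _ _ this]
  have step: "S M = conv (\<lambda>A. yf_tuples k y A - (if A = {} then 1 else 0)) S (M - {Min M})"
    if "finite M" "M \<noteq> {}" for M
    using that unfolding S_def yf_tuples_minus_empty[OF k] by simp
  from this have step: "min_rec S (\<lambda>N. conv (\<lambda>A. yf_tuples k y A - (if A = {} then 1 else 0)) S N)" by (rule min_recI)
  note inv = card_inv_yf_tuples[OF k]
  show S: "card_inv S"
    by (rule card_inv_step[OF step]) (auto intro!: card_inv_below_intros inv[THEN card_inv_imp_below])
  show "fps_deriv (egf S) = (egf (yf_tuples k y) - 1) * egf S"
    by (subst fps_deriv_egf[OF step]) (simp_all add: egf_simps card_inv_intros S inv)
qed (simp add: egf_nth_0 S_def leafless_weight_def yf_weight_def)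


section \<open>Forests without young and removable leaves\<close>

fun gamma_weight :: "nat \<Rightarrow> (tree list list \<Rightarrow> bool) \<Rightarrow> real \<Rightarrow> tree list \<Rightarrow> real" where
  "gamma_weight k P y [] = 0"
| "gamma_weight k P y (T # F) = (if top_removable k (children T) F then 0 else
     yf_weight y (concat (children T)) *
       (if F = [] then if P (children T) then 1 else 0 else gamma_weight k P y F))"

text \<open>
  A pair of a forest \<open>b\<close> below a root, ending in a removable leaf, and the remaining forest \<open>F\<close> is
  encoded by \<open>b @ F\<close>: the removable leaf has a smaller label than the next root, so this is again a
  forest, and it can be split back at its first one-node tree.
\<close>

fun removed_weight :: "nat \<Rightarrow> (tree list list \<Rightarrow> bool) \<Rightarrow> real \<Rightarrow> tree list \<Rightarrow> real" where
  "removed_weight k P y [] = 0"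
| "removed_weight k P y (T # F) = (if leaf T then y * gamma_weight k P y F else
     yf_weight y (concat (children T)) * removed_weight k P y F)"

lemma yf_weight_Cons:
  assumes "\<forall>t\<in>set F. label T < label t"
  shows "yf_weight y (T # F) =
    (if leaf T then if F = [] then y else 0 else yf_weight y (concat (children T)) * yf_weight y F)"
  using assms by (cases T) (auto simp: yf_weight_def young_free_Cons lleaf_Cons young_free_tree_iff power_add leaf_def)

text \<open>The recursion runs up to the first leaf s, which is last in the sibling list
  \<open>p @ [s]\<close> and hence not young. There y and the factors collected on the way recombine
  into the weight of that list.\<close>

lemma removed_weight_append:
  assumes "sorted_wrt (<) (map label (p @ [s]))" "leaf s" "\<forall>t\<in>set p. \<not> leaf t"
  shows "removed_weight k P y (p @ s # F) = yf_weight y (p @ [s]) * gamma_weight k P y F"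
  using assms
proof (induction p)
  case Nil
  thus ?case using yf_weight_Cons[of "[]" s y] by simp
next
  case (Cons T p)
  thus ?case using yf_weight_Cons[of "p @ [s]" T y] by simp
qed

lemma removed_weight_leafless: "\<forall>t\<in>set F. \<not> leaf t \<Longrightarrow> removed_weight k P y F = 0"
  by (induction F) auto

lemma first_leaf_split_unique:
  assumes "p @ s # F = p' @ s' # F'" "leaf s" "leaf s'" "\<forall>t\<in>set p. \<not> leaf t" "\<forall>t\<in>set p'. \<not> leaf t"
  shows "p = p' \<and> s = s' \<and> F = F'"
proof -
  have "takeWhile (\<lambda>t. \<not> leaf t) (p @ s # F) = p" if "leaf s" "\<forall>t\<in>set p. \<not> leaf t" for p s F
    using that by (simp add: takeWhile_append2)
  hence "p = p'" using assms by metis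
  thus ?thesis using assms(1) by simp
qed

lemma kforests_append_iff:
  "b @ F \<in> kforests k N \<longleftrightarrow>
     set (forest_labels b) \<subseteq> N \<and> b \<in> kforests k (set (forest_labels b)) \<and>
     F \<in> kforests k (N - set (forest_labels b)) \<and> (b = [] \<or> F = [] \<or> label (last b) < label (hd F))"
proof -
  have "sorted_wrt (<) (map label b @ map label F) \<longleftrightarrow>
      sorted_wrt (<) (map label b) \<and> sorted_wrt (<) (map label F) \<and>
      (b = [] \<or> F = [] \<or> label (last b) < label (hd F))"
  proof (cases "b = [] \<or> F = []")
    case False
    then obtain p s T G where eq: "b = p @ [s]" "F = T # G" by (metis neq_Nil_conv rev_exhaust)
    show ?thesis by (auto simp: eq sorted_wrt_append) (metis order.strict_trans)+
  qed auto
  thus ?thesis unfolding kforests_def by auto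
qed

text \<open>The left side is the weight lost to the condition on the first tree, N being the labels
  without its root. \<open>first_empty\<close> reduces the tuple to one forest b, and without young
  leaves the removable leaf is the last tree of b. Concatenation is then a bijection onto the
  forests whose first one-node tree is followed by another tree.\<close>

lemma sum_removed:
  assumes k: "k \<ge> 1" and N: "finite N"
  shows "(\<Sum>A\<in>Pow N. \<Sum>cs\<in>ktuples k A. \<Sum>F\<in>kforests k (N - A).
            if top_removable k cs F then yf_weight y (concat cs) * gamma_weight k P y F else 0) =
         fsum k (removed_weight k P y) N"
proof -
  define hit where "hit b F \<longleftrightarrow> (\<exists>u\<in>set b. leaf u \<and> (F = [] \<or> label u < label (hd F)))" for b F
  define q where "q b F = (if hit b F then yf_weight y b * gamma_weight k P y F else 0)" for b F
  define ends where "ends b \<longleftrightarrow> (\<exists>p s. b = p @ [s] \<and> leaf s \<and> (\<forall>t\<in>set p. \<not> leaf t))" for b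
  define D where "D = (SIGMA A:Pow N. kforests k A \<times> kforests k (N - A))"
  \<comment> \<open>Pairs with \<open>F = []\<close> may be dropped because
    \<open>gamma_weight\<close> is 0 there.\<close>
  define S where "S = {(A, b, F) \<in> D. ends b \<and> F \<noteq> [] \<and> label (last b) < label (hd F)}"
  define S' where "S' = {G \<in> kforests k N. \<exists>p s F. G = p @ s # F \<and> leaf s \<and> (\<forall>t\<in>set p. \<not> leaf t) \<and> F \<noteq> []}"
  have finA: "finite A" if "A \<in> Pow N" for A using that N finite_subset by auto
  have finD: "finite D" unfolding D_def using N finA finite_kforests[OF k] by (intro finite_SigmaI) auto
  have "(\<Sum>A\<in>Pow N. \<Sum>cs\<in>ktuples k A. \<Sum>F\<in>kforests k (N - A).
            if top_removable k cs F then yf_weight y (concat cs) * gamma_weight k P y F else 0) =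
        (\<Sum>A\<in>Pow N. \<Sum>b\<in>kforests k A. \<Sum>F\<in>kforests k (N - A). q b F)"
  proof (rule sum.cong[OF refl])
    fix A assume A: "A \<in> Pow N"
    have "(\<Sum>cs\<in>ktuples k A. \<Sum>F\<in>kforests k (N - A).
            if top_removable k cs F then yf_weight y (concat cs) * gamma_weight k P y F else 0) =
        ksum k (\<lambda>cs. if first_empty k cs then (\<Sum>F\<in>kforests k (N - A). q (concat cs) F) else 0) A"
      unfolding ksum_def by (intro sum.cong refl) (auto simp: top_removable_def q_def hit_def intro!: sum.cong)
    also have "\<dots> = (\<Sum>b\<in>kforests k A. \<Sum>F\<in>kforests k (N - A). q b F)"
      using ksum_first_empty[OF k finA[OF A]] by (simp add: fsum_def)
    finally show "(\<Sum>cs\<in>ktuples k A. \<Sum>F\<in>kforests k (N - A).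
            if top_removable k cs F then yf_weight y (concat cs) * gamma_weight k P y F else 0) =
        (\<Sum>b\<in>kforests k A. \<Sum>F\<in>kforests k (N - A). q b F)" .
  qed
  also have "\<dots> = (\<Sum>(A, b, F)\<in>D. q b F)"
    unfolding D_def sum.cartesian_product using N finA finite_kforests[OF k]
    by (subst sum.Sigma) (auto simp: case_prod_unfold)
  also have "\<dots> = (\<Sum>(A, b, F)\<in>S. q b F)"
  proof (rule sum.mono_neutral_right[OF finD])
    have "q b F = 0" if D: "(A, b, F) \<in> D" and notS: "(A, b, F) \<notin> S" for A b F
    proof (rule ccontr)
      assume "q b F \<noteq> 0"
      hence *: "hit b F" "young_free b" "F \<noteq> []"
        by (auto simp: q_def yf_weight_def split: if_splits)
      then obtain u where u: "u \<in> set b" "leaf u" "label u < label (hd F)" by (auto simp: hit_def)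
      then obtain p s where b: "b = p @ [s]" by (metis empty_iff list.set(1) rev_exhaust)
      have lt: "label t < label s" if "t \<in> set p" for t
        using D that by (auto simp: D_def kforests_def b sorted_wrt_append)
      have "\<not> leaf t" if "t \<in> set p" for t
        using *(2) lt[OF that] that by (auto simp: young_free_def b)
      hence "u = s" and "ends b" using u by (auto simp: b ends_def)
      thus False using notS D * u by (auto simp: S_def b)
    qed
    thus "\<forall>i\<in>D - S. (case i of (A, b, F) \<Rightarrow> q b F) = 0" by auto
  qed (auto simp: S_def)
  also have "\<dots> = (\<Sum>p\<in>S. removed_weight k P y (case p of (A, b, F) \<Rightarrow> b @ F))"
  proof (rule sum.cong[OF refl], clarsimp)
    fix A b F assume "(A, b, F) \<in> S"
    then obtain p s where b: "b = p @ [s]" "leaf s" "\<forall>t\<in>set p. \<not> leaf t"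
      and bF: "b \<in> kforests k A" "F \<noteq> []" "label (last b) < label (hd F)"
      by (auto simp: S_def D_def ends_def)
    have "hit b F" using b bF by (auto simp: hit_def)
    moreover have "sorted_wrt (<) (map label (p @ [s]))" using bF b by (simp add: kforests_def)
    ultimately show "q b F = removed_weight k P y (b @ F)"
      using removed_weight_append[of p s k P y F] b by (simp add: q_def)
  qed
  also have "\<dots> = (\<Sum>G\<in>S'. removed_weight k P y G)"
  proof (rule sum.reindex_bij_betw, rule bij_betwI')
    fix p q assume "p \<in> S" "q \<in> S"
    then obtain A b F B c G where eq: "p = (A, b, F)" "q = (B, c, G)"
      and 1: "(A, b, F) \<in> S" "(B, c, G) \<in> S" by (metis prod_cases3)
    have "p = q" if app: "b @ F = c @ G"
    proof -
      obtain r s r' s' where "b = r @ [s]" "leaf s" "\<forall>t\<in>set r. \<not> leaf t"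
         "c = r' @ [s']" "leaf s'" "\<forall>t\<in>set r'. \<not> leaf t" using 1 by (auto simp: S_def ends_def)
      hence "b = c \<and> F = G" using first_leaf_split_unique[of r s F r' s' G] app by simp
      moreover have "A = set (forest_labels b)" "B = set (forest_labels c)"
        using 1 by (auto simp: S_def D_def kforests_def)
      ultimately show ?thesis using eq by simp
    qed
    thus "((case p of (A, b, F) \<Rightarrow> b @ F) = (case q of (A, b, F) \<Rightarrow> b @ F)) = (p = q)"
      using eq by auto
  next
    fix p assume "p \<in> S"
    then obtain A b F where eq: "p = (A, b, F)" and 1: "(A, b, F) \<in> S" by (metis prod_cases3)
    have "A = set (forest_labels b)" using 1 by (auto simp: S_def D_def kforests_def)
    hence "b @ F \<in> kforests k N" using 1 by (auto simp: kforests_append_iff S_def D_def)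
    moreover have "\<exists>p s G. b @ F = p @ s # G \<and> leaf s \<and> (\<forall>t\<in>set p. \<not> leaf t) \<and> G \<noteq> []"
    proof -
      obtain p s where "b = p @ [s]" "leaf s" "\<forall>t\<in>set p. \<not> leaf t" "F \<noteq> []"
        using 1 by (auto simp: S_def ends_def)
      thus ?thesis by (intro exI[of _ p] exI[of _ s] exI[of _ F]) simp
    qed
    ultimately show "(case p of (A, b, F) \<Rightarrow> b @ F) \<in> S'" using eq by (simp add: S'_def)
  next
    fix G assume "G \<in> S'"
    then obtain p s F where G: "G \<in> kforests k N" "G = (p @ [s]) @ F" "leaf s"
        "\<forall>t\<in>set p. \<not> leaf t" "F \<noteq> []" by (auto simp: S'_def)
    have "(set (forest_labels (p @ [s])), p @ [s], F) \<in> S"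
      using G(1)[unfolded G(2), THEN kforests_append_iff[THEN iffD1]] G(3-)
      unfolding S_def D_def ends_def by simp
    thus "\<exists>p\<in>S. G = (case p of (A, b, F) \<Rightarrow> b @ F)" using G(2) by (intro bexI) auto
  qed
  also have "\<dots> = fsum k (removed_weight k P y) N"
    unfolding fsum_def
  proof (rule sum.mono_neutral_left)
    \<comment> \<open>Outside \<open>S'\<close> there is no one-node tree, or the first one stands
      at the end, where the factor \<open>gamma_weight k P y []\<close> vanishes.\<close>
    have "removed_weight k P y G = 0" if G: "G \<in> kforests k N" "G \<notin> S'" for G
    proof (cases "\<exists>t\<in>set G. leaf t")
      case True
      then obtain p s F where pF: "G = p @ s # F" "leaf s" "\<forall>t\<in>set p. \<not> leaf t"
        by (metis split_list_first_prop)
      hence "F = []" using G unfolding S'_def by blast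
      moreover have "sorted_wrt (<) (map label (p @ [s]))"
        using G pF \<open>F = []\<close> by (simp add: kforests_def)
      ultimately show ?thesis using removed_weight_append[of p s k P y F] pF by simp
    qed (simp add: removed_weight_leafless)
    thus "\<forall>i\<in>kforests k N - S'. removed_weight k P y i = 0" by simp
  qed (use finite_kforests[OF k N] in \<open>auto simp: S'_def\<close>)
  finally show ?thesis .
qed

lemma fsum_add: "fsum k (\<lambda>F. f F + g F) M = fsum k f M + fsum k g M"
  by (simp add: fsum_def sum.distrib)

text \<open>X has no product structure, but X plus the weight lost at the first tree has, and that
  lost weight is W on the labels without the minimum.\<close>

lemma egf_gamma:
  fixes y :: real
  assumes k: "k \<ge> 1" and P: "\<And>cs. P (prune_top cs) \<longleftrightarrow> P cs"
  defines "X \<equiv> fsum k (gamma_weight k P y)" and "W \<equiv> fsum k (removed_weight k P y)"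
    and "L \<equiv> ksum k (\<lambda>cs. if P cs \<and> \<not> top_removable k cs [] then yf_weight y (concat cs) else 0)"
  assumes L: "card_inv L"
  shows "card_inv X"
    and "fps_deriv (egf X) = egf (yf_tuples k y) * egf X + egf L - egf W"
    and "fps_deriv (egf W) = (egf (yf_tuples k y) - 1) * egf W + fps_const y * egf X"
    and "egf X $ 0 = 0" "egf W $ 0 = 0"
proof -
  note [simp del] = concat_eq_Nil_conv
  define r where "r G = (case G of [] \<Rightarrow> 0 | T # F \<Rightarrow>
    if top_removable k (children T) F then yf_weight y (concat (children T)) * gamma_weight k P y F else 0)" for G
  have stepX: "min_rec X (\<lambda>N. conv (yf_tuples k y) X N + L N - W N)"
  proof (rule min_recI)
    fix M :: "nat set" assume M: "finite M" "M \<noteq> {}"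
    have "fsum k (\<lambda>F. gamma_weight k P y F + r F) M =
        conv (yf_tuples k y) X (M - {Min M}) + L (M - {Min M})"
      unfolding X_def L_def yf_tuples_def
      by (rule fsum_step[OF M k]) (simp add: r_def P)
    moreover have "fsum k r M = W (M - {Min M})"
      unfolding fsum_rec[OF M k] W_def r_def using sum_removed[OF k, of "M - {Min M}" y P] M by (simp cong: if_cong)
    ultimately show "X M = conv (yf_tuples k y) X (M - {Min M}) + L (M - {Min M}) - W (M - {Min M})"
      by (simp add: fsum_add X_def)
  qed
  have stepW: "min_rec W (\<lambda>N. conv (\<lambda>A. yf_tuples k y A - (if A = {} then 1 else 0)) W N + y * X N)"
  proof (rule min_recI)
    fix M :: "nat set" assume M: "finite M" "M \<noteq> {}"
    \<comment> \<open>\<open>f\<close> collects the forests that start with a one-node tree, where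
      the recursion of \<open>removed_weight\<close> stops; \<open>g\<close> collects the
      others.\<close>
    define f where "f G = (case G of [] \<Rightarrow> 0 | T # F \<Rightarrow> if leaf T then y * gamma_weight k P y F else 0)" for G
    define g where "g G = (case G of [] \<Rightarrow> 0 | T # F \<Rightarrow> if leaf T then 0 else
        yf_weight y (concat (children T)) * removed_weight k P y F)" for G
    have "removed_weight k P y = (\<lambda>G. g G + f G)"
    proof
      fix G show "removed_weight k P y G = g G + f G" by (cases G) (auto simp: f_def g_def)
    qed
    hence "W M = fsum k g M + fsum k f M" by (simp add: W_def fsum_add)
    also have "fsum k f M = conv (ksum k (\<lambda>cs. if concat cs = [] then y else 0)) X (M - {Min M}) +
        ksum k (\<lambda>cs. 0) (M - {Min M})"
      unfolding X_def by (rule fsum_step[OF M k]) (simp add: f_def prune_top_eq_Nil)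
    also have "\<dots> = y * X (M - {Min M})" using M by (simp add: ksum_delta[OF k] conv_empty)
    also have "fsum k g M = conv (ksum k (\<lambda>cs. if concat cs = [] then 0 else yf_weight y (concat cs))) W (M - {Min M}) +
        ksum k (\<lambda>cs. 0) (M - {Min M})"
      unfolding W_def by (rule fsum_step[OF M k]) (simp add: g_def prune_top_eq_Nil)
    finally show "W M = conv (\<lambda>A. yf_tuples k y A - (if A = {} then 1 else 0)) W (M - {Min M}) + y * X (M - {Min M})"
      by (simp add: yf_tuples_minus_empty[OF k])
  qed
  note inv = card_inv_yf_tuples[OF k, of y]
  \<comment> \<open>The recursions of X and W refer to each other, so invariance needs a
    simultaneous induction.\<close>
  have "card_inv_below n X \<and> card_inv_below n W" for n
  proof (induction n)
    case (Suc n)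
    thus ?case
      by (intro conjI card_inv_below_Suc[OF _ stepX] card_inv_below_Suc[OF _ stepW]
            card_inv_below_intros inv[THEN card_inv_imp_below] L[THEN card_inv_imp_below]) auto
  qed (simp add: card_inv_below_0)
  hence XW: "card_inv X" "card_inv W" by (auto simp: card_inv_def)
  show "card_inv X" by fact
  show "fps_deriv (egf X) = egf (yf_tuples k y) * egf X + egf L - egf W"
    by (subst fps_deriv_egf[OF stepX]) (simp_all add: egf_simps card_inv_intros XW inv L)
  show "fps_deriv (egf W) = (egf (yf_tuples k y) - 1) * egf W + fps_const y * egf X"
    by (subst fps_deriv_egf[OF stepW]) (simp_all add: egf_simps card_inv_intros XW inv)
qed (simp_all add: egf_nth_0 X_def W_def)


section \<open>Rescaling and the Eulerian series\<close>

lemma egf_cong: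
  assumes "\<And>M. finite M \<Longrightarrow> S M = T M"
  shows "egf S = egf T" and "card_inv S \<longleftrightarrow> card_inv T"
  using assms unfolding egf_def card_inv_def card_inv_below_def by auto

text \<open>Both \<open>U - 1\<close> and \<open>S * (Vs - 1)\<close> solve the Riccati equation w'
  = K (w^2 + S w + X) with w(0) = 0; the constant terms agree because s^2 y = x. The difference of
  two solutions v, w has derivative (w - v) K (w + v + S), so it obeys a linear equation and
  vanishes.\<close>

lemma yf_tuples_scale:
  fixes x :: real
  assumes k: "k \<ge> 1" and x: "x \<noteq> -1"
  shows "egf (all_tuples k x) - 1 =
    fps_const (1 + x) * (fps_scale (1 + x) (egf (yf_tuples k (x / (1 + x)\<^sup>2))) - 1)"
proof -
  define X S Y K where const: "X = fps_const x" "S = fps_const (1 + x)" "Y = fps_const (x / (1 + x)\<^sup>2)"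
    "K = fps_const (real k)"
  define U where "U = egf (all_tuples k x)"
  define V where "V = egf (yf_tuples k (x / (1 + x)\<^sup>2))"
  define Vs where "Vs = fps_scale (1 + x) V"
  have S: "S = 1 + X" and XY: "S * S * Y = X" using x
    by (simp_all add: const power2_eq_square flip: fps_const_1_eq_1 fps_const_add)
  have dU: "fps_deriv U = K * ((U + (X - 1)) * U)"
    using egf_all_tuples(1)[OF k, of x] by (simp add: U_def const)
  have "fps_deriv Vs = S * (K * ((Vs - 1) * Vs + Y))"
    using egf_yf_tuples(1)[OF k, of "x / (1 + x)\<^sup>2"]
    by (simp add: Vs_def V_def const fps_deriv_scale fps_scale_mult fps_scale_simps)
  hence "fps_deriv (U - 1 - S * (Vs - 1)) =
      K * ((U + (X - 1)) * U) - S * (S * (K * ((Vs - 1) * Vs + Y)))"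
    using dU by (simp add: const)
  also have "\<dots> = (U - 1 - S * (Vs - 1)) * (K * (U - 1 + S * (Vs - 1) + S))"
    using S XY by algebra
  finally have "U - 1 - S * (Vs - 1) = 0"
    by (rule fps_linear_ode_zero)
       (simp add: U_def Vs_def V_def const fps_scale_nth egf_all_tuples(2)[OF k] egf_yf_tuples(2)[OF k])
  thus ?thesis by (simp add: U_def Vs_def V_def const)
qed

text \<open>The scaling relation reads \<open>S * Vs = U + X\<close>, so Z' = (U + X) Z + Q - W, to
  be compared with H' = U H + D. This dictates the identity \<open>X * Z + Q - W = D\<close>, which
  holds since both sides solve the linear equation of D. The factor 1/(1+x) in Z accounts for degree
  n - 1.\<close>

lemma bar_scale:
  fixes x :: real
  assumes k: "k \<ge> 1" and x: "x \<noteq> -1" and M: "finite M"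
  shows "(1 + x) * fsum k (last_weight (first_empty k) x) M =
    (1 + x) ^ card M * fsum k (gamma_weight k (first_empty k) (x / (1 + x)\<^sup>2)) M"
proof -
  define X S Y where const: "X = fps_const x" "S = fps_const (1 + x)" "Y = fps_const (x / (1 + x)\<^sup>2)"
  define y where "y = x / (1 + x)\<^sup>2"
  define U where "U = egf (all_tuples k x)"
  define Vs where "Vs = fps_scale (1 + x) (egf (yf_tuples k y))"
  define D where "D = egf (fsum k (\<lambda>F. x ^ lleaf F))"
  define H where "H = egf (fsum k (last_weight (first_empty k) x))"
  define Q where "Q = fps_scale (1 + x) (egf (fsum k (leafless_weight y)))"
  define W where "W = fps_scale (1 + x) (egf (fsum k (removed_weight k (first_empty k) y)))"
  define Z where "Z = fps_const (1 / (1 + x)) * fps_scale (1 + x) (egf (fsum k (gamma_weight k (first_empty k) y)))"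
  have S: "S = 1 + X" and XY: "S * S * Y = X" and S1: "S * fps_const (1 / (1 + x)) = 1" using x
    by (simp_all add: const power2_eq_square flip: fps_const_1_eq_1 fps_const_add)
  have UV: "U - 1 = S * (Vs - 1)" using yf_tuples_scale[OF k x] by (simp add: U_def Vs_def const y_def)
  have SZ: "fps_scale (1 + x) (egf (fsum k (gamma_weight k (first_empty k) y))) = S * Z"
    using S1 by (simp add: Z_def flip: mult.assoc)
  have L1: "ksum k (\<lambda>cs. if first_empty k cs then x ^ lleaf (concat cs) else 0) A = fsum k (\<lambda>F. x ^ lleaf F) A"
    if "finite A" for A by (rule ksum_first_empty[OF k that])
  have L2: "ksum k (\<lambda>cs. if first_empty k cs \<and> \<not> top_removable k cs [] then yf_weight y (concat cs) else 0) A =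
      fsum k (leafless_weight y) A" if "finite A" for A
  proof -
    have "(if first_empty k cs \<and> \<not> top_removable k cs [] then yf_weight y (concat cs) else 0) =
        (if first_empty k cs then leafless_weight y (concat cs) else 0)" for cs
      by (auto simp: top_removable_def leafless_weight_def)
    thus ?thesis using ksum_first_empty[OF k that] by simp
  qed
  note leafy = egf_leafy_forests[OF k, of x]
  note leafless = egf_leafless_forests[OF k, of y]
  have C1: "egf (ksum k (\<lambda>cs. if first_empty k cs then x ^ lleaf (concat cs) else 0)) = D"
      "card_inv (ksum k (\<lambda>cs. if first_empty k cs then x ^ lleaf (concat cs) else 0))"
    using egf_cong[OF L1] leafy(1) by (simp_all add: D_def)
  have C2: "egf (ksum k (\<lambda>cs. if first_empty k cs \<and> \<not> top_removable k cs [] then yf_weight y (concat cs) else 0)) =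
        egf (fsum k (leafless_weight y))"
      "card_inv (ksum k (\<lambda>cs. if first_empty k cs \<and> \<not> top_removable k cs [] then yf_weight y (concat cs) else 0))"
    using egf_cong[OF L2] leafless(1) by simp_all
  note last = egf_last[OF k, where P = "first_empty k" and x = x, OF first_empty_prune_top C1(2)]
  note gam = egf_gamma[OF k, where P = "first_empty k" and y = y, OF first_empty_prune_top C2(2)]
  have dH: "fps_deriv H = U * H + D" using last(2) C1(1) by (simp add: H_def U_def)
  have dD: "fps_deriv D = (U + (X - 1)) * D" using leafy(2) by (simp add: D_def U_def const)
  have dZ: "fps_deriv Z = Vs * (S * Z) + Q - W"
    using S1 gam(2) C2(1)
    by (simp add: Z_def fps_deriv_scale fps_scale_mult fps_scale_simps Vs_def Q_def W_def const
        flip: mult.assoc)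
  have dW: "fps_deriv W = S * ((Vs - 1) * W + Y * (S * Z))"
    using gam(3) SZ by (simp add: W_def fps_deriv_scale fps_scale_mult fps_scale_simps Vs_def const y_def)
  have dQ: "fps_deriv Q = S * ((Vs - 1) * Q)"
    using leafless(2) by (simp add: Q_def fps_deriv_scale fps_scale_mult fps_scale_simps Vs_def const)
  have "fps_deriv (X * Z + Q - W) = X * (Vs * (S * Z) + Q - W) + S * ((Vs - 1) * Q) - S * ((Vs - 1) * W + Y * (S * Z))"
    by (simp add: dZ dW dQ const)
  also have "\<dots> = (U + (X - 1)) * (X * Z + Q - W) + 0"
    using S XY UV by algebra
  finally have D: "X * Z + Q - W = D"
    by (rule fps_linear_ode_unique)
       (use dD gam(4,5) leafless(3) leafy(3) in \<open>simp_all add: Z_def Q_def W_def D_def const fps_scale_nth\<close>)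
  have "fps_deriv Z = U * Z + D" unfolding dZ D[symmetric] using S UV by algebra
  hence "Z = H"
    by (rule fps_linear_ode_unique[OF _ dH])
       (use gam(4) last(3) in \<open>simp add: Z_def H_def fps_scale_nth\<close>)
  have "H $ card M = (1 / (1 + x)) * ((1 + x) ^ card M * egf (fsum k (gamma_weight k (first_empty k) y)) $ card M)"
    unfolding \<open>Z = H\<close>[symmetric] by (simp add: Z_def fps_scale_nth)
  thus ?thesis using card_invD[OF last(1) M] card_invD[OF gam(1) M] x
    by (simp add: H_def y_def)
qed

text \<open>Now Z' = (U + X) Z + (U + X) - S E - S W, and comparison with H' = U H + (U - D)
  dictates \<open>S * E + S * W - X * Z - X\<close> as the expression for D. The degree is n, so Z
  carries no factor 1/s.\<close>

lemma hat_scale: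
  fixes x :: real
  assumes k: "k \<ge> 1" and x: "x \<noteq> -1" and M: "finite M"
  shows "fsum k (last_weight (\<lambda>cs. \<not> first_empty k cs) x) M =
    (1 + x) ^ card M * fsum k (gamma_weight k (\<lambda>cs. \<not> first_empty k cs) (x / (1 + x)\<^sup>2)) M"
proof -
  define X S Y where const: "X = fps_const x" "S = fps_const (1 + x)" "Y = fps_const (x / (1 + x)\<^sup>2)"
  define y where "y = x / (1 + x)\<^sup>2"
  define U where "U = egf (all_tuples k x)"
  define Vs where "Vs = fps_scale (1 + x) (egf (yf_tuples k y))"
  define D where "D = egf (fsum k (\<lambda>F. x ^ lleaf F))"
  define H where "H = egf (fsum k (last_weight (\<lambda>cs. \<not> first_empty k cs) x))"
  define E where "E = fps_scale (1 + x) (egf (fsum k (yf_weight y)))"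
  define W where "W = fps_scale (1 + x) (egf (fsum k (removed_weight k (\<lambda>cs. \<not> first_empty k cs) y)))"
  define Z where "Z = fps_scale (1 + x) (egf (fsum k (gamma_weight k (\<lambda>cs. \<not> first_empty k cs) y)))"
  have S: "S = 1 + X" and XY: "S * S * Y = X" using x
    by (simp_all add: const power2_eq_square flip: fps_const_1_eq_1 fps_const_add)
  have UV: "U - 1 = S * (Vs - 1)" using yf_tuples_scale[OF k x] by (simp add: U_def Vs_def const y_def)
  have split: "ksum k (\<lambda>cs. if \<not> first_empty k cs then f (concat cs) else 0) A =
      ksum k (\<lambda>cs. f (concat cs)) A - fsum k f A" if "finite A" for A f
  proof -
    have "ksum k (\<lambda>cs. f (concat cs)) A = ksum k (\<lambda>cs. if \<not> first_empty k cs then f (concat cs) else 0) A +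
        ksum k (\<lambda>cs. if first_empty k cs then f (concat cs) else 0) A"
      unfolding ksum_def sum.distrib[symmetric] by (intro sum.cong) auto
    thus ?thesis using ksum_first_empty[OF k that, of f] by simp
  qed
  have L1: "ksum k (\<lambda>cs. if \<not> first_empty k cs then x ^ lleaf (concat cs) else 0) A =
      all_tuples k x A - fsum k (\<lambda>F. x ^ lleaf F) A"
    if "finite A" for A unfolding all_tuples_def by (rule split[OF that])
  have L2: "ksum k (\<lambda>cs. if \<not> first_empty k cs \<and> \<not> top_removable k cs [] then yf_weight y (concat cs) else 0) A =
      yf_tuples k y A - fsum k (yf_weight y) A" if "finite A" for A
  proof -
    \<comment> \<open>Removability requires empty first k - 1 children, which the last tree of the
      second class does not have.\<close>
    have "(\<not> first_empty k cs \<and> \<not> top_removable k cs []) = (\<not> first_empty k cs)" for cs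
      by (auto simp: top_removable_def)
    thus ?thesis using split[OF that] by (simp add: yf_tuples_def)
  qed
  have P: "(\<not> first_empty k (prune_top cs)) = (\<not> first_empty k cs)" for cs :: "tree list list" by simp
  note leafy = egf_leafy_forests[OF k, of x]
  note yf = egf_yf_forests[OF k, of y]
  have C1: "egf (ksum k (\<lambda>cs. if \<not> first_empty k cs then x ^ lleaf (concat cs) else 0)) = U - D"
      "card_inv (ksum k (\<lambda>cs. if \<not> first_empty k cs then x ^ lleaf (concat cs) else 0))"
    using egf_cong[OF L1] card_inv_intros(3)[OF card_inv_all_tuples[OF k] leafy(1)]
    by (simp_all add: D_def U_def egf_diff)
  have C2: "egf (ksum k (\<lambda>cs. if \<not> first_empty k cs \<and> \<not> top_removable k cs [] then yf_weight y (concat cs) else 0)) =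
        egf (yf_tuples k y) - egf (fsum k (yf_weight y))"
      "card_inv (ksum k (\<lambda>cs. if \<not> first_empty k cs \<and> \<not> top_removable k cs [] then yf_weight y (concat cs) else 0))"
    using egf_cong[OF L2] card_inv_intros(3)[OF card_inv_yf_tuples[OF k] yf(1)]
    by (simp_all add: egf_diff)
  note last = egf_last[OF k, where P = "\<lambda>cs. \<not> first_empty k cs" and x = x, OF P C1(2)]
  note gam = egf_gamma[OF k, where P = "\<lambda>cs. \<not> first_empty k cs" and y = y, OF P C2(2)]
  have dH: "fps_deriv H = U * H + (U - D)" using last(2) C1(1) by (simp add: H_def U_def)
  have dD: "fps_deriv D = (U + (X - 1)) * D" using leafy(2) by (simp add: D_def U_def const)
  have dZ: "fps_deriv Z = S * (Vs * Z + (Vs - E) - W)"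
    using gam(2) C2(1)
    by (simp add: Z_def fps_deriv_scale fps_scale_mult fps_scale_simps Vs_def E_def W_def const egf_diff)
  have dW: "fps_deriv W = S * ((Vs - 1) * W + Y * Z)"
    using gam(3) by (simp add: W_def Z_def fps_deriv_scale fps_scale_mult fps_scale_simps Vs_def const y_def)
  have dE: "fps_deriv E = S * ((Vs - 1) * E + Y)"
    using yf(2) by (simp add: E_def fps_deriv_scale fps_scale_mult fps_scale_simps Vs_def const y_def)
  have "fps_deriv (S * E + S * W - X * Z - X) = S * (S * ((Vs - 1) * E + Y)) + S * (S * ((Vs - 1) * W + Y * Z)) -
      X * (S * (Vs * Z + (Vs - E) - W))"
    by (simp add: dZ dW dE const)
  also have "\<dots> = (U + (X - 1)) * (S * E + S * W - X * Z - X) + 0"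
    using S XY UV by algebra
  finally have D: "S * E + S * W - X * Z - X = D"
    by (rule fps_linear_ode_unique)
       (use dD gam(4,5) yf(3) leafy(3) in \<open>simp_all add: Z_def E_def W_def D_def const fps_scale_nth\<close>)
  have "fps_deriv Z = U * Z + (U - D)" unfolding dZ D[symmetric] using S UV by algebra
  hence "Z = H"
    by (rule fps_linear_ode_unique[OF _ dH])
       (use gam(4) last(3) in \<open>simp add: Z_def H_def fps_scale_nth\<close>)
  have "H $ card M = (1 + x) ^ card M * egf (fsum k (gamma_weight k (\<lambda>cs. \<not> first_empty k cs) y)) $ card M"
    unfolding \<open>Z = H\<close>[symmetric] by (simp add: Z_def fps_scale_nth)
  thus ?thesis using card_invD[OF last(1) M] card_invD[OF gam(1) M]
    by (simp add: H_def y_def)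
qed

text \<open>The logistic equation for U has the solution (1 - x) e / (e - x) with e = exp(k (x - 1)
  z). As F' = U F and (e - x)' = -k U (e - x), the product F^k (e - x) is constant; the constant
  term 1 of F selects the right k-th root.\<close>

lemma eulerian_egf_eq:
  fixes x :: real
  assumes k: "k \<ge> 1" and x: "x \<noteq> 1"
  shows "eulerian_egf k x = egf (fsum k (\<lambda>F. x ^ nonroot_leaves F))"
proof -
  define X K where const: "X = fps_const x" "K = fps_const (real k)"
  define e where "e = fps_exp (real k * (x - 1))"
  define U where "U = egf (all_tuples k x)"
  define F where "F = egf (fsum k (\<lambda>F. x ^ nonroot_leaves F))"
  have F: "fps_deriv F = U * F" "F $ 0 = 1" using egf_forests[OF k, of x] by (simp_all add: F_def U_def)
  have dU: "fps_deriv U = K * ((U + (X - 1)) * U)" and U0: "U $ 0 = 1"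
    using egf_all_tuples[OF k, of x] by (simp_all add: U_def const)
  have de: "fps_deriv e = K * ((X - 1) * e)" by (simp add: e_def const)
  have "fps_deriv (U * (e - X) - (1 - X) * e) =
      U * (K * ((X - 1) * e)) + K * ((U + (X - 1)) * U) * (e - X) - (1 - X) * (K * ((X - 1) * e))"
    using dU de by (simp add: const)
  also have "\<dots> = (U * (e - X) - (1 - X) * e) * (K * (U + X - 1))" by algebra
  finally have "U * (e - X) - (1 - X) * e = 0"
    by (rule fps_linear_ode_zero) (simp add: U0 const e_def)
  hence Ue: "U * (e - X) = (1 - X) * e" by simp
  obtain h where h: "k = Suc h" using k by (cases k) auto
  have "fps_deriv (F ^ k * (e - X)) = F ^ k * fps_deriv (e - X) + fps_deriv (F ^ k) * (e - X)"
    by (rule fps_deriv_mult)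
  also have "fps_deriv (e - X) = K * ((X - 1) * e)" using de by (simp add: const)
  also have "fps_deriv (F ^ k) = K * (U * F) * F ^ h"
    by (subst fps_deriv_power) (simp add: F h const)
  also have "F ^ k * (K * ((X - 1) * e)) + K * (U * F) * F ^ h * (e - X) =
      K * (F * F ^ h * (U * (e - X) - (1 - X) * e))"
    unfolding h power_Suc by algebra
  finally have "fps_deriv (F ^ k * (e - X)) = 0" by (simp add: Ue)
  hence "F ^ k * (e - X) = fps_const ((F ^ k * (e - X)) $ 0)"
    using fps_deriv_eq_0_iff by blast
  also have "(F ^ k * (e - X)) $ 0 = 1 - x" by (simp add: F const e_def fps_power_zeroth)
  finally have Fk: "F ^ k * (e - X) = fps_const (1 - x)" .
  have eX: "(e - X) $ 0 \<noteq> 0" using x by (simp add: e_def const)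
  have "F ^ k = fps_const (1 - x) / (e - X)"
    unfolding Fk[symmetric] using eX by (simp add: fps_divide_unit inverse_mult_eq_1' mult.assoc)
  moreover have "F = fps_radical root (Suc h) (F ^ Suc h)"
    using radical_unique[of root h "F ^ Suc h" F] F by (simp add: fps_power_zeroth)
  ultimately show ?thesis
    unfolding eulerian_egf_def h[symmetric] F_def[symmetric] by (simp add: e_def const h)
qed


section \<open>Old, young and removable leaves\<close>

fun gamma_forest :: "nat \<Rightarrow> tree list \<Rightarrow> bool" where
  "gamma_forest k [] \<longleftrightarrow> True"
| "gamma_forest k (T # F) \<longleftrightarrow> young_free_tree T \<and> \<not> top_removable k (children T) F \<and> gamma_forest k F"

lemma gamma_weight_eq:
  "gamma_weight k P y F =
     (if F \<noteq> [] \<and> P (children (last F)) \<and> gamma_forest k F then y ^ nonroot_leaves F else 0)"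
  by (induction F) (auto simp: yf_weight_def young_free_tree_iff inner_leaves_def power_add)

lemma gamma_forest_iff:
  "gamma_forest k F \<longleftrightarrow> (\<forall>T\<in>set F. young_free_tree T) \<and>
     (\<forall>i<length F. \<not> top_removable k (children (F ! i)) (drop (Suc i) F))"
proof (induction F)
  case (Cons T F)
  have "(\<forall>i<length (T # F). \<not> top_removable k (children ((T # F) ! i)) (drop (Suc i) (T # F))) \<longleftrightarrow>
      \<not> top_removable k (children T) F \<and>
      (\<forall>i<length F. \<not> top_removable k (children (F ! i)) (drop (Suc i) F))"
    by (simp add: All_less_Suc2)
  thus ?case using Cons by auto
qed simp

lemma labels_inj:
  assumes "distinct (forest_labels G)" "s \<in> set G" "t \<in> set G" "l \<in> set (labels s)" "l \<in> set (labels t)"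
  shows "s = t"
  using assms by (induction G) (auto simp: set_forest_labels)

lemma distinct_labels_tree: "distinct (forest_labels G) \<Longrightarrow> t \<in> set G \<Longrightarrow> distinct (labels t)"
  by (induction G) auto

lemma label_inj:
  assumes "distinct (forest_labels G)" "s \<in> set G" "t \<in> set G" "label s = label t"
  shows "s = t"
  using labels_inj[OF assms(1-3)] label_in_labels assms(4) by metis

lemma set_forest_labels_nodes: "set (forest_labels G) = label ` set (concat (map nodes G))"
  by (auto simp: forest_labels_def labels_def)

lemma grand_children_Node [simp]: "grand_children (Node m bs) = set (concat bs)"
  by (simp add: grand_children_def)

lemma nonroot_nodes:
  "set (concat (map nodes (concat (children T)))) = {v. \<exists>u\<in>set (nodes T). v \<in> grand_children u}"
proof (induction T rule: tree_forest_induct)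
  case (Node m bs)
  have "set (nodes t) = insert t {v. \<exists>u\<in>set (nodes t). v \<in> grand_children u}"
    if "t \<in> set (concat bs)" for t
    unfolding Node[OF that, symmetric] by (cases t) (simp add: nodes_eq)
  hence "set (concat (map nodes (concat bs))) =
      (\<Union>t\<in>set (concat bs). insert t {v. \<exists>u\<in>set (nodes t). v \<in> grand_children u})"
    by auto
  also have "\<dots> = {v. \<exists>u\<in>set (nodes (Node m bs)). v \<in> grand_children u}"
    by (auto simp: nodes_eq)
  finally show ?case by simp
qed

lemma label_grand_child:
  assumes "u \<in> set (nodes T)" "v \<in> grand_children u" "distinct (labels T)"
  shows "label v \<in> set (labels T)" "label v \<noteq> label T"
proof -
  have "v \<in> set (concat (map nodes (concat (children T))))"
    using assms unfolding nonroot_nodes by blast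
  hence "label v \<in> set (forest_labels (concat (children T)))"
    unfolding set_forest_labels_nodes by blast
  thus "label v \<in> set (labels T)" "label v \<noteq> label T"
    using assms(3) by (cases T; auto simp: labels_Node)+
qed

text \<open>\<open>old\<close> quantifies existentially over the grand parent, and nodes are
  identified with subtrees; distinct labels exclude that the same subtree hangs below two
  nodes.\<close>

lemma grand_parent_unique:
  assumes "distinct (labels T)" "u \<in> set (nodes T)" "u' \<in> set (nodes T)"
    "v \<in> grand_children u" "v \<in> grand_children u'"
  shows "u = u'"
  using assms
proof (induction T rule: tree_forest_induct)
  case (Node m bs)
  let ?T = "Node m bs"
  have dist: "distinct (forest_labels (concat bs))" using Node.prems by (simp add: labels_Node)
  have no: False if w: "w \<in> set (nodes t)" "v \<in> grand_children w" and t: "t \<in> set (concat bs)"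
    and v: "v \<in> set (concat bs)" for w t
  proof -
    have "label v \<in> set (labels t)" "label v \<noteq> label t"
      using label_grand_child[OF w distinct_labels_tree[OF dist t]] .
    moreover have "v = t" using labels_inj[OF dist v t label_in_labels] calculation by blast
    ultimately show False by simp
  qed
  have sub: "w = ?T \<or> (\<exists>t\<in>set (concat bs). w \<in> set (nodes t))" if "w \<in> set (nodes ?T)" for w
    using that by (auto simp: nodes_eq)
  show ?case
  proof (cases "u = ?T \<or> u' = ?T")
    case True
    hence "v \<in> set (concat bs)" using Node.prems by auto
    thus ?thesis using no sub Node.prems by metis
  next
    case False
    then obtain t t' where t: "t \<in> set (concat bs)" "u \<in> set (nodes t)"
      "t' \<in> set (concat bs)" "u' \<in> set (nodes t')" using sub Node.prems by blast
    have "label v \<in> set (labels t)" "label v \<in> set (labels t')"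
      using label_grand_child(1) distinct_labels_tree[OF dist] t Node.prems by metis+
    hence "t = t'" using labels_inj[OF dist] t by blast
    thus ?thesis using Node.IH[OF t(1)] t Node.prems distinct_labels_tree[OF dist] by metis
  qed
qed

lemma young_free_tree_nodes:
  "young_free_tree T \<longleftrightarrow> (\<forall>u\<in>set (nodes T). \<forall>v\<in>grand_children u. leaf v \<longrightarrow>
     (\<forall>w\<in>grand_children u. label w \<le> label v))"
proof (induction T rule: tree_forest_induct)
  case (Node m bs)
  have "young_free_tree (Node m bs) \<longleftrightarrow> (\<forall>t\<in>set (concat bs). young_free_tree t) \<and>
      (\<forall>v\<in>set (concat bs). leaf v \<longrightarrow> (\<forall>w\<in>set (concat bs). label w \<le> label v))"
    unfolding young_free_tree_iff[of "Node m bs"] young_free_def by auto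
  also have "(\<forall>t\<in>set (concat bs). young_free_tree t) \<longleftrightarrow>
      (\<forall>t\<in>set (concat bs). \<forall>u\<in>set (nodes t). \<forall>v\<in>grand_children u. leaf v \<longrightarrow>
         (\<forall>w\<in>grand_children u. label w \<le> label v))"
    using Node by blast
  finally show ?case unfolding nodes_eq by auto
qed

lemma kforests_distinct_labels:
  assumes "F \<in> kforests k M" "T \<in> set F"
  shows "distinct (labels T)"
  using assms distinct_labels_tree by (auto simp: kforests_def)

lemma young_leaves_empty_iff:
  assumes "F \<in> kforests k M"
  shows "young_leaves F = {} \<longleftrightarrow> (\<forall>T\<in>set F. young_free_tree T)"
proof -
  have "(\<forall>v. leaf v \<longrightarrow> \<not> young T v) \<longleftrightarrow> young_free_tree T" if T: "T \<in> set F" for T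
  proof
    assume Y: "\<forall>v. leaf v \<longrightarrow> \<not> young T v"
    show "young_free_tree T" unfolding young_free_tree_nodes
    proof (intro ballI impI)
      fix u v w assume *: "u \<in> set (nodes T)" "v \<in> grand_children u" "leaf v" "w \<in> grand_children u"
      hence "old T v" using Y by (auto simp: young_def)
      then obtain u' where u': "u' \<in> set (nodes T)" "v \<in> grand_children u'"
        "\<forall>w\<in>grand_children u'. label w \<le> label v" by (auto simp: old_def)
      hence "u' = u" using grand_parent_unique[OF kforests_distinct_labels[OF assms T]] * by blast
      thus "label w \<le> label v" using u' * by simp
    qed
  next
    assume "young_free_tree T"
    thus "\<forall>v. leaf v \<longrightarrow> \<not> young T v" unfolding young_free_tree_nodes young_def old_def by blast
  qed
  thus ?thesis unfolding young_leaves_def by blast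
qed

lemma removable_iff:
  assumes F: "F \<in> kforests k M" and i: "i < length F" and yf: "young_free_tree (F ! i)"
  shows "(\<exists>u. removable k F i u) \<longleftrightarrow> top_removable k (children (F ! i)) (drop (Suc i) F)"
proof -
  let ?T = "F ! i"
  have dist: "distinct (forest_labels (concat (children ?T)))"
    using kforests_distinct_labels[OF F nth_mem[OF i]] by (cases ?T) (simp add: labels_Node)
  have next_label: "(drop (Suc i) F = [] \<or> label u < label (hd (drop (Suc i) F))) \<longleftrightarrow>
      (Suc i < length F \<longrightarrow> label u < label (F ! Suc i))" for u
    by (cases "Suc i < length F") (auto simp: hd_drop_conv_nth)
  have *: "old ?T u \<and> (\<forall>w\<in>grand_children ?T. leaf w \<longrightarrow> w = u)"
    if "u \<in> grand_children ?T" "leaf u" for u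
  proof -
    have max: "\<forall>w\<in>grand_children ?T. label w \<le> label v" if "v \<in> grand_children ?T" "leaf v" for v
      using yf that root_in_nodes[of ?T] unfolding young_free_tree_nodes by blast
    have "w = u" if "w \<in> grand_children ?T" "leaf w" for w
      using max[OF that] max[OF \<open>u \<in> grand_children ?T\<close> \<open>leaf u\<close>] that \<open>u \<in> grand_children ?T\<close>
        label_inj[OF dist, of w u] unfolding grand_children_def by fastforce
    thus ?thesis using max[OF that] that root_in_nodes[of ?T] unfolding old_def by blast
  qed
  show ?thesis
    unfolding removable_def top_removable_def next_label first_empty_def first_children_leaves_def
    using * unfolding grand_children_def by blast
qed

lemma gamma_forest_correct:
  assumes "F \<in> kforests k M"
  shows "young_leaves F = {} \<and> removable_old_leaves k F = {} \<longleftrightarrow> gamma_forest k F"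
  using removable_iff[OF assms] young_leaves_empty_iff[OF assms]
  unfolding gamma_forest_iff removable_old_leaves_def by (auto simp del: drop_Suc)

lemma lleaf_append [simp]: "lleaf (F @ G) = lleaf F + lleaf G"
  by (simp add: lleaf_def)

text \<open>Without young leaves every leaf other than a root is old, and distinct labels let a set
  of nodes be counted by a list.\<close>

lemma card_old_leaves:
  assumes F: "F \<in> kforests k M" and yf: "\<forall>T\<in>set F. young_free_tree T"
  shows "card (old_leaves F) = nonroot_leaves F"
proof -
  define G where "G = concat (concat (map children F))"
  define ns where "ns = concat (map nodes G)"
  have old: "{v. leaf v \<and> old T v} = {v \<in> set (concat (map nodes (concat (children T)))). leaf v}"
    if "T \<in> set F" for T
    unfolding nonroot_nodes old_def using yf[rule_format, OF that, unfolded young_free_tree_nodes] by blast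
  have "old_leaves F = (\<Union>T\<in>set F. {v. leaf v \<and> old T v})" by (auto simp: old_leaves_def)
  also have "\<dots> = (\<Union>T\<in>set F. {v \<in> set (concat (map nodes (concat (children T)))). leaf v})"
    using old by (intro SUP_cong) auto
  also have "\<dots> = set (filter leaf ns)" by (auto simp: ns_def G_def)
  finally have "old_leaves F = set (filter leaf ns)" .
  moreover have "distinct (forest_labels G)"
  proof -
    have "distinct (forest_labels F)" using F by (simp add: kforests_def)
    thus ?thesis unfolding G_def
    proof (induction F)
      case (Cons T F)
      have "set (forest_labels (concat (concat (map children F)))) \<subseteq> set (forest_labels F)" for F
      proof (induction F)
        case (Cons T F)
        thus ?case by (cases T) (auto simp: labels_Node)
      qed simp
      thus ?case using Cons by (cases T) (auto simp: labels_Node)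
    qed simp
  qed
  hence "distinct (map label ns)"
    by (simp add: ns_def forest_labels_def labels_def[abs_def] map_concat comp_def)
  hence "distinct ns" by (simp add: distinct_map)
  ultimately have "card (old_leaves F) = length (filter leaf ns)"
    using distinct_card[of "filter leaf ns"] by (simp only: distinct_filter)
  also have "\<dots> = lleaf G" by (simp add: lleaf_def ns_def)
  also have "\<dots> = nonroot_leaves F" unfolding G_def
    by (induction F) (auto simp: inner_leaves_def)
  finally show ?thesis .
qed

section \<open>Bounds on the exponents\<close>

text \<open>A one-node tree adds 2 on the left and 1 to each term on the right; any other tree adds
  at most one per label.\<close>

lemma twice_lleaf_le:
  assumes "\<And>t. t \<in> set G \<Longrightarrow> 2 * inner_leaves t \<le> length (labels t) - (if leaf t then 1 else 0)"
  shows "2 * lleaf G \<le> length (forest_labels G) + length (filter leaf G)"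
  using assms
proof (induction G)
  case (Cons t G)
  have "2 * inner_leaves t \<le> length (labels t) - (if leaf t then 1 else 0)" "length (labels t) \<ge> 1"
    using Cons.prems labels_nonempty[of t] by (auto simp: Suc_le_eq)
  moreover have "2 * lleaf G \<le> length (forest_labels G) + length (filter leaf G)"
    using Cons by simp
  ultimately show ?case by (cases "leaf t") (simp_all add: lleaf_Cons)
qed simp

lemma length_filter_le_1:
  assumes "distinct G" "\<And>s t. s \<in> set G \<Longrightarrow> t \<in> set G \<Longrightarrow> P s \<Longrightarrow> P t \<Longrightarrow> s = t"
  shows "length (filter P G) \<le> 1"
proof -
  have "length (filter P G) = card (set (filter P G))" using assms(1) by (intro distinct_card[symmetric] distinct_filter)
  also have "\<dots> \<le> 1" unfolding One_nat_def using assms(2) by (subst card_le_Suc0_iff_eq) auto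
  finally show ?thesis .
qed

lemma distinct_forest: "distinct (forest_labels G) \<Longrightarrow> distinct G"
  using label_in_labels by (induction G) (auto simp: set_forest_labels)

text \<open>Pair each leaf other than the root with its grand parent. Without young leaves a node
  has at most one leaf grand child, and a grand parent is no leaf, so the pairs are disjoint. If no
  grand child of the root is a leaf, the root stays unpaired and one label is saved.\<close>

lemma twice_inner_leaves_le:
  assumes "distinct (labels T)" "young_free_tree T"
  shows "2 * inner_leaves T \<le> length (labels T)"
    and "\<forall>t\<in>grand_children T. \<not> leaf t \<Longrightarrow> 2 * inner_leaves T \<le> length (labels T) - 1"
proof -
  \<comment> \<open>Strengthened for the induction: the number of leaf grand children tells whether
    the root is already in a pair.\<close>
  have "2 * inner_leaves T \<le> length (labels T) - 1 + length (filter leaf (concat (children T))) \<and>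
      length (filter leaf (concat (children T))) \<le> 1"
    using assms
  proof (induction T rule: tree_forest_induct)
    case (Node m bs)
    let ?G = "concat bs"
    have dist: "distinct (forest_labels ?G)" using Node.prems by (simp add: labels_Node)
    have yf: "young_free ?G" using Node.prems by (simp add: young_free_tree_iff)
    have "length (filter leaf ?G) \<le> 1"
    proof (rule length_filter_le_1[OF distinct_forest[OF dist]])
      fix s t assume *: "s \<in> set ?G" "t \<in> set ?G" "leaf s" "leaf t"
      hence "label s = label t" using yf unfolding young_free_def by (meson order.antisym)
      thus "s = t" using label_inj[OF dist] * by blast
    qed
    moreover have "2 * lleaf ?G \<le> length (forest_labels ?G) + length (filter leaf ?G)"
    proof (rule twice_lleaf_le)
      fix t assume t: "t \<in> set ?G"
      have "2 * inner_leaves t \<le> length (labels t) - 1 + length (filter leaf (concat (children t))) \<and>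
          length (filter leaf (concat (children t))) \<le> 1"
        using Node.IH[OF t] distinct_labels_tree[OF dist t] yf t by (auto simp: young_free_def)
      moreover have "length (labels t) \<ge> 1" using labels_nonempty[of t] by (simp add: Suc_le_eq)
      moreover have "inner_leaves t = 0" if "leaf t" using that by (cases t) simp
      ultimately show "2 * inner_leaves t \<le> length (labels t) - (if leaf t then 1 else 0)" by auto
    qed
    ultimately show ?case by (simp add: labels_Node)
  qed
  moreover have "length (labels T) \<ge> 1" using labels_nonempty[of T] by (simp add: Suc_le_eq)
  moreover have "filter leaf (concat (children T)) = []" if "\<forall>t\<in>grand_children T. \<not> leaf t"
    using that unfolding grand_children_def filter_empty_conv .
  ultimately show "2 * inner_leaves T \<le> length (labels T)"
    and "\<forall>t\<in>grand_children T. \<not> leaf t \<Longrightarrow> 2 * inner_leaves T \<le> length (labels T) - 1"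
    by auto
qed

text \<open>In the first class a leaf grand child of the last root would be removable, so that root
  is unpaired; this is why the degree drops to n - 1.\<close>

lemma twice_nonroot_leaves_le:
  assumes "distinct (forest_labels F)" "gamma_forest k F" "F \<noteq> []"
  shows "2 * nonroot_leaves F \<le> length (forest_labels F) - (if first_empty k (children (last F)) then 1 else 0)"
  using assms
proof (induction F)
  case (Cons T F)
  have T: "2 * inner_leaves T \<le> length (labels T)"
    "\<forall>t\<in>grand_children T. \<not> leaf t \<Longrightarrow> 2 * inner_leaves T \<le> length (labels T) - 1"
    using twice_inner_leaves_le[of T] Cons.prems by auto
  show ?case
  proof (cases "F = []")
    case True
    hence "\<forall>t\<in>grand_children T. \<not> leaf t" if "first_empty k (children T)"
      using Cons.prems that by (auto simp: top_removable_def grand_children_def)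
    thus ?thesis using T True by auto
  next
    case False
    hence "length (forest_labels F) \<ge> 1" by (simp add: Suc_le_eq)
    thus ?thesis using Cons False T(1) by auto
  qed
qed simp

lemma lleaf_pos: "wf_tree k t \<Longrightarrow> t \<in> set F \<Longrightarrow> lleaf F \<ge> 1"
proof (induction t arbitrary: F rule: tree_forest_induct)
  case (Node m bs)
  obtain G H where F: "F = G @ Node m bs # H" using Node.prems by (metis split_list)
  show ?case
  proof (cases "bs = []")
    case False
    then obtain b t where t: "b \<in> set bs" "t \<in> set b" using Node.prems by (metis wf_tree.simps last_in_set)
    hence "t \<in> set (concat bs)" "wf_tree k t" using Node.prems by auto
    hence "lleaf (concat bs) \<ge> 1" using Node.IH by blast
    thus ?thesis by (simp add: F lleaf_Cons)
  qed (simp add: F lleaf_Cons)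
qed

text \<open>In the second class something hangs below the last root, and every tree contains a leaf.
  Hence the lower summation limit 1.\<close>

lemma nonroot_leaves_pos:
  assumes "F \<in> kforests k M" "F \<noteq> []" "\<not> first_empty k (children (last F))"
  shows "nonroot_leaves F \<ge> 1"
proof -
  obtain G T where F: "F = G @ [T]" using assms(2) by (metis rev_exhaust)
  obtain m bs where T: "T = Node m bs" by (cases T)
  obtain b where b: "b \<in> set bs" "b \<noteq> []"
    using assms(3) unfolding F T first_empty_def by (auto dest: in_set_takeD)
  then obtain t where "t \<in> set b" by (metis last_in_set)
  moreover have "wf_tree k T" using assms(1) by (auto simp: kforests_def F)
  ultimately have "lleaf (concat bs) \<ge> 1" using b lleaf_pos[of k t "concat bs"] by (auto simp: T)
  thus ?thesis by (simp add: F T nonroot_leaves_def)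
qed


section \<open>Gamma expansions\<close>

lemma forests_eq: "forests n k = kforests k {1..n}"
  by (auto simp: forests_def inc_forest_iff)

lemma finite_forests: "k \<ge> 1 \<Longrightarrow> finite (forests n k)"
  by (simp add: forests_eq finite_kforests)

lemma forests_nonempty: "n \<ge> 1 \<Longrightarrow> F \<in> forests n k \<Longrightarrow> F \<noteq> []"
  unfolding forests_eq using kforests_Nil_iff[of F k "{1..n}"] by auto

lemma length_forest_labels: "F \<in> kforests k M \<Longrightarrow> length (forest_labels F) = card M"
  by (auto simp: kforests_def distinct_card)

text \<open>A singleton has no children, so the condition on the first k - 1 children holds for it
  vacuously.\<close>

lemma forests_bar_iff:
  "F \<in> forests_bar n k \<longleftrightarrow> F \<in> forests n k \<and> first_empty k (children (last F))"
  by (auto simp: forests_bar_def singleton_def first_children_leaves_def first_empty_def)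

lemma forests_hat_iff:
  "F \<in> forests_hat n k \<longleftrightarrow> F \<in> forests n k \<and> \<not> first_empty k (children (last F))"
  by (auto simp: forests_hat_def forests_bar_iff)

definition good_forests :: "nat \<Rightarrow> tree list set \<Rightarrow> nat \<Rightarrow> tree list set" where
  "good_forests k \<F> i = {F \<in> \<F>.
     card (old_leaves F) = i \<and> young_leaves F = {} \<and> removable_old_leaves k F = {}}"

lemma good_forests_eq:
  assumes "\<F> \<subseteq> forests n k"
  shows "good_forests k \<F> i = {F \<in> \<F>. gamma_forest k F \<and> nonroot_leaves F = i}"
proof -
  have "(card (old_leaves F) = i \<and> young_leaves F = {} \<and> removable_old_leaves k F = {}) \<longleftrightarrow>
      gamma_forest k F \<and> nonroot_leaves F = i" if "F \<in> \<F>" for F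
  proof -
    have F: "F \<in> kforests k {1..n}" using that assms by (auto simp: forests_eq)
    show ?thesis
      using gamma_forest_correct[OF F] card_old_leaves[OF F] young_leaves_empty_iff[OF F] by auto
  qed
  thus ?thesis by (auto simp: good_forests_def)
qed

lemma sum_gamma:
  assumes k: "k \<ge> 1" and "\<F> \<subseteq> forests n k" "finite I"
    and "\<And>F. F \<in> \<F> \<Longrightarrow> gamma_forest k F \<Longrightarrow> nonroot_leaves F \<in> I"
  shows "(\<Sum>F\<in>{F \<in> \<F>. gamma_forest k F}. y ^ nonroot_leaves F) =
    (\<Sum>i\<in>I. real (card (good_forests k \<F> i)) * y ^ i)"
proof -
  have fin: "finite {F \<in> \<F>. gamma_forest k F}"
    using finite_subset[OF assms(2) finite_forests[OF k]] by simp
  have "(\<Sum>F\<in>{F \<in> \<F>. gamma_forest k F}. y ^ nonroot_leaves F) =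
      (\<Sum>i\<in>I. \<Sum>F\<in>{F \<in> {F \<in> \<F>. gamma_forest k F}. nonroot_leaves F = i}. y ^ nonroot_leaves F)"
    by (rule sum.group[OF fin assms(3), symmetric]) (use assms(4) in auto)
  also have "\<dots> = (\<Sum>i\<in>I. real (card (good_forests k \<F> i)) * y ^ i)"
  proof (rule sum.cong[OF refl])
    fix i
    have "{F \<in> {F \<in> \<F>. gamma_forest k F}. nonroot_leaves F = i} = good_forests k \<F> i"
      unfolding good_forests_eq[OF assms(2)] by auto
    moreover have "(\<Sum>F\<in>good_forests k \<F> i. y ^ nonroot_leaves F) = (\<Sum>F\<in>good_forests k \<F> i. y ^ i)"
      by (rule sum.cong) (auto simp: good_forests_eq[OF assms(2)])
    ultimately show "(\<Sum>F\<in>{F \<in> {F \<in> \<F>. gamma_forest k F}. nonroot_leaves F = i}. y ^ nonroot_leaves F) =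
        real (card (good_forests k \<F> i)) * y ^ i" by simp
  qed
  finally show ?thesis .
qed

lemma fsum_restrict:
  assumes "k \<ge> 1" and "\<And>F. F \<in> kforests k {1..n} \<Longrightarrow> f F = (if F \<in> \<F> then g F else 0)"
    and "\<F> \<subseteq> forests n k"
  shows "fsum k f {1..n} = (\<Sum>F\<in>\<F>. g F)"
proof -
  have "fsum k f {1..n} = (\<Sum>F\<in>forests n k. if F \<in> \<F> then g F else 0)"
    unfolding fsum_def forests_eq by (rule sum.cong) (use assms(2) in auto)
  also have "\<dots> = (\<Sum>F\<in>forests n k \<inter> \<F>. g F)"
    by (rule sum.inter_restrict[OF finite_forests[OF assms(1)], symmetric])
  also have "forests n k \<inter> \<F> = \<F>" using assms(3) by auto
  finally show ?thesis .
qed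

definition leaf_poly :: "tree list set \<Rightarrow> real poly" where
  "leaf_poly \<F> = (\<Sum>F\<in>\<F>. monom 1 (lleaf F - si F))"

lemma poly_leaf_poly: "poly (leaf_poly \<F>) x = (\<Sum>F\<in>\<F>. x ^ nonroot_leaves F)"
  by (simp add: leaf_poly_def poly_sum poly_monom lleaf_minus_si)

lemma eulerian_poly_eq_leaf_poly:
  assumes k: "k \<ge> 1"
  shows "eulerian_poly k n = leaf_poly (forests n k)"
proof (rule poly_eqI_cofinite[of "{1}"])
  fix x :: real assume "x \<notin> {1}"
  hence "poly (eulerian_poly k n) x = fact n * eulerian_egf k x $ n"
    using eulerian_poly[OF k, of x n] by (simp add: field_simps)
  also have "\<dots> = fsum k (\<lambda>F. x ^ nonroot_leaves F) {1..n}"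
    using eulerian_egf_eq[OF k, of x] \<open>x \<notin> {1}\<close> card_invD[OF egf_forests(1)[OF k, of x], of "{1..n}"] by simp
  finally show "poly (eulerian_poly k n) x = poly (leaf_poly (forests n k)) x"
    by (simp add: poly_leaf_poly fsum_def forests_eq)
qed simp

lemma gamma_bar_expansion:
  assumes n: "n \<ge> 1" and k: "k \<ge> 1"
  shows "leaf_poly (forests_bar n k) =
    (\<Sum>i=0..(n - 1) div 2. of_nat (gamma_bar n k i) * monom 1 i * [:1, 1:] ^ (n - 1 - 2 * i))"
proof (rule poly_eqI_cofinite[of "{-1}"])
  fix x :: real assume "x \<notin> {-1}"
  hence x: "x \<noteq> -1" "1 + x \<noteq> 0" by auto
  let ?y = "x / (1 + x)\<^sup>2"
  have sub: "forests_bar n k \<subseteq> forests n k" by (auto simp: forests_bar_iff)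
  have "fsum k (last_weight (first_empty k) x) {1..n} = (\<Sum>F\<in>forests_bar n k. x ^ nonroot_leaves F)"
    by (rule fsum_restrict[OF k _ sub])
       (use forests_nonempty[OF n] in \<open>auto simp: last_weight_def forests_bar_iff forests_eq\<close>)
  moreover have "fsum k (gamma_weight k (first_empty k) ?y) {1..n} =
      (\<Sum>F\<in>{F \<in> forests_bar n k. gamma_forest k F}. ?y ^ nonroot_leaves F)"
    by (rule fsum_restrict[OF k])
       (use forests_nonempty[OF n] in \<open>auto simp: gamma_weight_eq forests_bar_iff forests_eq\<close>)
  moreover have "\<dots> = (\<Sum>i=0..(n - 1) div 2. real (gamma_bar n k i) * ?y ^ i)"
  proof -
    have "nonroot_leaves F \<in> {0..(n - 1) div 2}" if "F \<in> forests_bar n k" "gamma_forest k F" for F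
    proof -
      have F: "F \<in> kforests k {1..n}" "F \<noteq> []" "first_empty k (children (last F))"
        using that forests_nonempty[OF n] by (auto simp: forests_bar_iff forests_eq)
      hence "2 * nonroot_leaves F \<le> n - 1"
        using twice_nonroot_leaves_le[of F k] that(2) length_forest_labels[OF F(1)] by (simp add: kforests_def)
      thus ?thesis by auto
    qed
    thus ?thesis using sum_gamma[OF k sub, of "{0..(n - 1) div 2}" ?y]
      by (simp add: gamma_bar_def good_forests_def)
  qed
  ultimately have "(1 + x) * poly (leaf_poly (forests_bar n k)) x =
      (1 + x) ^ n * (\<Sum>i=0..(n - 1) div 2. real (gamma_bar n k i) * ?y ^ i)"
    using bar_scale[OF k x(1), of "{1..n}"] by (simp add: poly_leaf_poly)
  \<comment> \<open>One factor 1 + x cancels against the left side, leaving the exponent n -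
    1.\<close>
  also have "(1 + x) ^ n = (1 + x) * (1 + x) ^ (n - 1)" using n by (cases n) auto
  finally have "poly (leaf_poly (forests_bar n k)) x =
      (1 + x) ^ (n - 1) * (\<Sum>i=0..(n - 1) div 2. real (gamma_bar n k i) * ?y ^ i)"
    using x by (simp only: mult.assoc mult_cancel_left) simp
  also have "\<dots> = (\<Sum>i=0..(n - 1) div 2. real (gamma_bar n k i) * (x ^ i * (1 + x) ^ (n - 1 - 2 * i)))"
    unfolding sum_distrib_left
  proof (rule sum.cong[OF refl])
    fix i assume "i \<in> {0..(n - 1) div 2}"
    hence "n - 1 - 2 * i + 2 * i = n - 1" by auto
    hence "(1 + x) ^ (n - 1) = (1 + x) ^ (n - 1 - 2 * i) * ((1 + x)\<^sup>2) ^ i"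
      by (simp flip: power_add power_mult)
    thus "(1 + x) ^ (n - 1) * (real (gamma_bar n k i) * ?y ^ i) =
        real (gamma_bar n k i) * (x ^ i * (1 + x) ^ (n - 1 - 2 * i))"
      using x by (simp add: power_divide)
  qed
  finally show "poly (leaf_poly (forests_bar n k)) x =
      poly (\<Sum>i=0..(n - 1) div 2. of_nat (gamma_bar n k i) * monom 1 i * [:1, 1:] ^ (n - 1 - 2 * i)) x"
    by (simp add: poly_sum poly_monom mult.assoc)
qed simp

lemma gamma_hat_expansion:
  assumes n: "n \<ge> 1" and k: "k \<ge> 1"
  shows "leaf_poly (forests_hat n k) =
    (\<Sum>i=1..n div 2. of_nat (gamma_hat n k i) * monom 1 i * [:1, 1:] ^ (n - 2 * i))"
proof (rule poly_eqI_cofinite[of "{-1}"])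
  fix x :: real assume "x \<notin> {-1}"
  hence x: "x \<noteq> -1" "1 + x \<noteq> 0" by auto
  let ?y = "x / (1 + x)\<^sup>2"
  have sub: "forests_hat n k \<subseteq> forests n k" by (auto simp: forests_hat_iff)
  have "fsum k (last_weight (\<lambda>cs. \<not> first_empty k cs) x) {1..n} = (\<Sum>F\<in>forests_hat n k. x ^ nonroot_leaves F)"
    by (rule fsum_restrict[OF k _ sub])
       (use forests_nonempty[OF n] in \<open>auto simp: last_weight_def forests_hat_iff forests_eq\<close>)
  moreover have "fsum k (gamma_weight k (\<lambda>cs. \<not> first_empty k cs) ?y) {1..n} =
      (\<Sum>F\<in>{F \<in> forests_hat n k. gamma_forest k F}. ?y ^ nonroot_leaves F)"
    by (rule fsum_restrict[OF k])
       (use forests_nonempty[OF n] in \<open>auto simp: gamma_weight_eq forests_hat_iff forests_eq\<close>)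
  moreover have "\<dots> = (\<Sum>i=1..n div 2. real (gamma_hat n k i) * ?y ^ i)"
  proof -
    have "nonroot_leaves F \<in> {1..n div 2}" if "F \<in> forests_hat n k" "gamma_forest k F" for F
    proof -
      have F: "F \<in> kforests k {1..n}" "F \<noteq> []" "\<not> first_empty k (children (last F))"
        using that forests_nonempty[OF n] by (auto simp: forests_hat_iff forests_eq)
      hence "2 * nonroot_leaves F \<le> n"
        using twice_nonroot_leaves_le[of F k] that(2) length_forest_labels[OF F(1)] by (simp add: kforests_def)
      thus ?thesis using nonroot_leaves_pos[OF F] by auto
    qed
    thus ?thesis using sum_gamma[OF k sub, of "{1..n div 2}" ?y]
      by (simp add: gamma_hat_def good_forests_def)
  qed
  ultimately have "poly (leaf_poly (forests_hat n k)) x =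
      (1 + x) ^ n * (\<Sum>i=1..n div 2. real (gamma_hat n k i) * ?y ^ i)"
    using hat_scale[OF k x(1), of "{1..n}"] by (simp add: poly_leaf_poly)
  also have "\<dots> = (\<Sum>i=1..n div 2. real (gamma_hat n k i) * (x ^ i * (1 + x) ^ (n - 2 * i)))"
    unfolding sum_distrib_left
  proof (rule sum.cong[OF refl])
    fix i assume "i \<in> {1..n div 2}"
    hence "n - 2 * i + 2 * i = n" by auto
    hence "(1 + x) ^ n = (1 + x) ^ (n - 2 * i) * ((1 + x)\<^sup>2) ^ i"
      by (simp flip: power_add power_mult)
    thus "(1 + x) ^ n * (real (gamma_hat n k i) * ?y ^ i) =
        real (gamma_hat n k i) * (x ^ i * (1 + x) ^ (n - 2 * i))"
      using x by (simp add: power_divide)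
  qed
  finally show "poly (leaf_poly (forests_hat n k)) x =
      poly (\<Sum>i=1..n div 2. of_nat (gamma_hat n k i) * monom 1 i * [:1, 1:] ^ (n - 2 * i)) x"
    by (simp add: poly_sum poly_monom mult.assoc)
qed simp

section \<open>Symmetry and the decomposition\<close>

lemma gamma_expansion_palindromic:
  fixes x :: real and c :: "nat \<Rightarrow> nat"
  assumes p: "p = (\<Sum>i\<in>I. of_nat (c i) * monom 1 i * [:1, 1:] ^ (d - 2 * i))"
    and I: "\<And>i. i \<in> I \<Longrightarrow> 2 * i \<le> d" and x: "x \<noteq> 0"
  shows "x ^ d * poly p (1 / x) = poly p x"
proof -
  have "x ^ d * ((1 / x) ^ i * (1 + 1 / x) ^ (d - 2 * i)) = x ^ i * (1 + x) ^ (d - 2 * i)" if "i \<in> I" for i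
  proof -
    have "d = i + (i + (d - 2 * i))" using I[OF that] by simp
    hence "x ^ d = x ^ i * (x ^ i * x ^ (d - 2 * i))" by (metis power_add)
    moreover have "x ^ (d - 2 * i) * (1 + 1 / x) ^ (d - 2 * i) = (1 + x) ^ (d - 2 * i)"
      unfolding power_mult_distrib[symmetric] using x by (simp add: distrib_left add.commute)
    ultimately show ?thesis using x by (simp add: power_divide)
  qed
  thus ?thesis unfolding p poly_sum sum_distrib_left
    by (intro sum.cong refl) (simp add: poly_monom mult_ac)
qed

theorem theorem2p4:
  fixes n k :: nat
  assumes "n \<ge> 1" and "k \<ge> 1"
  shows "eulerian_a k n = (\<Sum>F\<in>forests_bar n k. monom 1 (lleaf F - si F)) \<and>
         (\<Sum>F\<in>forests_bar n k. monom (1::real) (lleaf F - si F)) =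
           (\<Sum>i=0..(n - 1) div 2. of_nat (gamma_bar n k i) * monom 1 i * [:1, 1:] ^ (n - 1 - 2 * i)) \<and>
         [:0, 1:] * eulerian_b k n = (\<Sum>F\<in>forests_hat n k. monom 1 (lleaf F - si F)) \<and>
         (\<Sum>F\<in>forests_hat n k. monom (1::real) (lleaf F - si F)) =
           (\<Sum>i=1..n div 2. of_nat (gamma_hat n k i) * monom 1 i * [:1, 1:] ^ (n - 2 * i))"
proof -
  let ?a = "leaf_poly (forests_bar n k)" and ?c = "leaf_poly (forests_hat n k)"
  note bar = gamma_bar_expansion[OF assms] and hat = gamma_hat_expansion[OF assms]
  have sub: "forests_bar n k \<subseteq> forests n k" by (auto simp: forests_bar_def)
  have A: "eulerian_poly k n = ?a + ?c"
    unfolding eulerian_poly_eq_leaf_poly[OF assms(2)] leaf_poly_def forests_hat_def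
    using sum.subset_diff[OF sub finite_forests[OF assms(2)], of "\<lambda>F. monom (1::real) (lleaf F - si F)"]
    by (simp add: add.commute)
  have a_eq: "eulerian_a k n = ?a"
  proof (rule poly_eqI_cofinite[of "{0, 1}"])
    fix x :: real assume "x \<notin> {0, 1}"
    hence x: "x \<noteq> 0" "x \<noteq> 1" by auto
    \<comment> \<open>\<open>?a\<close> is symmetric for degree n - 1 and \<open>?c\<close> for
      degree n. In A(x) - x^n A(1/x) the part \<open>?c\<close> therefore cancels, and
      \<open>?a\<close> is left with the factor 1 - x.\<close>
    have "x ^ (n - 1) * poly ?a (1 / x) = poly ?a x"
      by (rule gamma_expansion_palindromic[OF bar _ x(1)]) auto
    moreover have "x ^ n * poly ?c (1 / x) = poly ?c x"
      by (rule gamma_expansion_palindromic[OF hat _ x(1)]) auto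
    moreover have "x ^ n = x * x ^ (n - 1)" using assms(1) by (cases n) auto
    ultimately have "poly (?a + ?c) x - x ^ n * poly (?a + ?c) (1 / x) = (1 - x) * poly ?a x"
      by (simp add: algebra_simps)
    thus "poly (eulerian_a k n) x = poly ?a x"
      using x by (simp add: eulerian_a[OF assms(2) x] A)
  qed simp
  moreover have "[:0, 1:] * eulerian_b k n = ?c"
    using eulerian_decomposition[OF assms] A a_eq by simp
  ultimately show ?thesis using bar hat unfolding leaf_poly_def by simp
qed

end
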